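(* Let $A=(A_0,A_1,A_2,A_3)$ be generic complex parameters. For every $k\in\{1,2,3,4\}$ and $i,j\in\{0,1,\dots,7\}$ with $i\ne j$, the series $$f_{k,ij}^{(0,A_0-1/2)}(A;x):=x^{A_0-\frac12}\sum_{n=0}^\infty W^{(1)}_{k,ij}(n;A)\,x^n$$ is a solution of $Z(A)$ at $x=0$ with exponent $A_0-\frac12$.
   Context: Notation: $A_{\varepsilon_0\varepsilon_1\varepsilon_2\varepsilon_3}=(\varepsilon_0A_0+\varepsilon_1A_1+\varepsilon_2A_2+\varepsilon_3A_3+1)/2$ for signs $\varepsilon_j=\pm$; $(a)_n=a(a+1)\cdots(a+n-1)$. Generic means outside a countable union of proper algebraic hypersurfaces of the parameter space. Put $${}_4\tilde f_3\!\left(\begin{matrix} a_0,a_1,a_2,a_3 \\ b_0,b_1,b_2,b_3 \end{matrix};x\right)=\sum_{n=0}^\infty\frac{\Gamma(a_0+n)\Gamma(a_1+n)\Gamma(a_2+n)\Gamma(a_3+n)}{\Gamma(b_0+n)\Gamma(b_1+n)\Gamma(b_2+n)\Gamma(b_3+n)}x^n.$$ For $\boldsymbol\alpha=(\alpha_0,\alpha_1,\alpha_2,\alpha_3;\beta_1,\beta_2,\beta_3)$ with $\beta_1+\beta_2+\beta_3-\alpha_0-\alpha_1-\alpha_2-\alpha_3=1$, define \begin{align*} y_0(\boldsymbol\alpha)&={}_4\tilde f_3\!\left(\begin{matrix} \alpha_0,\alpha_1,\alpha_2,\alpha_3 \\ 1,\beta_1,\beta_2,\beta_3 \end{matrix};1\right),\\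 y_i(\boldsymbol\alpha)&={}_4\tilde f_3\!\left(\begin{matrix} \alpha_0+1-\beta_i,\ \alpha_1+1-\beta_i,\ \alpha_2+1-\beta_i,\ \alpha_3+1-\beta_i \\ 2-\beta_i,\ \beta_1+1-\beta_i,\ \beta_2+1-\beta_i,\ \beta_3+1-\beta_i \end{matrix};1\right)\quad(i=1,2,3),\\ y_{i+4}(\boldsymbol\alpha)&=-\,{}_4\tilde f_3\!\left(\begin{matrix} \alpha_i,\ \alpha_i+1-\beta_1,\ \alpha_i+1-\beta_2,\ \alpha_i+1-\beta_3 \\ \alpha_i+1-\alpha_0,\ \alpha_i+1-\alpha_1,\ \alpha_i+1-\alpha_2,\ \alpha_i+1-\alpha_3 \end{matrix};1\right)\quad(i=0,1,2,3). \end{align*} Let $y_i(n;\boldsymbol\alpha)=y_i(\alpha_0-n,\alpha_1-n,\alpha_2,\alpha_3;\beta_1-n,\beta_2-n,\beta_3)$ and $D^{(1)}_{ij}(n;\boldsymbol\alpha)=y_i(n;\boldsymbol\alpha)-y_j(n;\boldsymbol\alpha)$. Consider the four parameter choices \begin{align*} \boldsymbol\alpha^{[1]}&=\left(\tfrac12,\ A_0+\tfrac12,\ A_{+---},\ A_{+-++};\ A_{+--+}+\tfrac12,\ A_{+-+-}+\tfrac12,\ A_0+1\right),\\ \boldsymbol\alpha^{[2]}&=\left(\tfrac12,\ A_2+\tfrac12,\ A_{--+-},\ A_{+-++};\ A_{--++}+\tfrac12,\ A_{+-+-}+\tfrac12,\ A_2+1\right),\\ \boldsymbol\alpha^{[3]}&=\left(A_0+\tfrac12,\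 A_2+\tfrac12,\ A_{+-++},\ A_{+-+-};\ A_{+-++}+\tfrac12,\ A_{+-+-}+\tfrac12,\ A_0+A_2+1\right),\\ \boldsymbol\alpha^{[4]}&=\left(A_2+\tfrac12,\ A_3+\tfrac12,\ A_{+-++},\ A_{--++};\ A_{+-++}+\tfrac12,\ A_{--++}+\tfrac12,\ A_2+A_3+1\right), \end{align*} and set $W^{(1)}_{k,ij}(n;A)=\lambda_k(n)\,D^{(1)}_{ij}(n;\boldsymbol\alpha^{[k]})$ with \begin{align*} \lambda_1(n)&=\frac{(\frac12)_n}{n!},&\lambda_2(n)&=\frac{(\frac12)_n(\frac12-A_2)_n(\frac12+A_2)_n}{n!\,(\frac12-A_0)_n(\frac12+A_0)_n},\\ \lambda_3(n)&=\frac{(\frac12-A_2)_n(\frac12+A_2)_n}{n!\,(\frac12)_n},&\lambda_4(n)&=\frac{(\frac12-A_2)_n(\frac12+A_2)_n(\frac12-A_3)_n(\frac12+A_3)_n}{n!\,(\frac12)_n(\frac12-A_0)_n(\frac12+A_0)_n}. \end{align*} With $\partial=d/dx$, $Z(A)=p_0\partial^4+p_1\partial^3+p_2\partial^2+p_3\partial+p_4$, where \begin{align*} p_0&=x^3(x-1)^2,\qquad p_1=-2x^2(x-1)(2A_0x-2A_0-5x+3),\\ p_2&=x\big[(6A_0^2-A_2^2-A_3^2-24A_0+25)x^2+(-11A_0^2-A_1^2+A_2^2+A_3^2+36A_0-\tfrac{59}2)x+\tfrac14(10A_0-9)(2A_0-3)\big],\\ p_3&=-(2A_0-3)(2A_0^2-A_2^2-A_3^2-6A_0+5)x^2+(A_0-1)(6A_0^2+2A_1^2-2A_2^2-2A_3^2-16A_0+11)x-\tfrac14(2A_0-3)(2A_0-1)^2,\\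 p_4&=(A_0-1+A_3)(A_0-1-A_3)(A_0-1+A_2)(A_0-1-A_2)\,x-\tfrac14(2A_0-1)^2(A_0^2+A_1^2-A_2^2-A_3^2-2A_0+1). \end{align*} Its local exponents at $x=0$ are $0,\ A_0-\frac12,\ A_0+\frac12,\ 2A_0$. For arbitrary $C_0,C_1$ there is a unique solution of the form $x^{A_0-1/2}\sum_{n\ge0}C_nx^n$; "solution with exponent $A_0-\frac12$" refers to a solution of this form. *)

theory Defs
  imports "HOL-Analysis.Analysis" "HOL-Computational_Algebra.Polynomial"
begin

type_synonym params = "complex \<times> complex \<times> complex \<times> complex"

text \<open>
  A polynomial in four variables is an iterated univariate polynomial; the innermost
  coefficients are polynomials in the first variable.
\<close>

definition poly4 :: "complex poly poly poly poly \<Rightarrow> params \<Rightarrow> complex" where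
  "poly4 P = (\<lambda>(A0, A1, A2, A3). poly (poly (poly (poly P [:[:[:A3:]:]:]) [:[:A2:]:]) [:A1:]) A0)"

definition proper_hypersurface :: "params set \<Rightarrow> bool" where
  "proper_hypersurface H \<longleftrightarrow> (\<exists>P. P \<noteq> 0 \<and> H = {A. poly4 P A = 0})"

definition holds_generically :: "(params \<Rightarrow> bool) \<Rightarrow> bool" where
  "holds_generically Q \<longleftrightarrow>
     (\<exists>\<H>. countable \<H> \<and> (\<forall>H\<in>\<H>. proper_hypersurface H) \<and> (\<forall>A. A \<notin> \<Union>\<H> \<longrightarrow> Q A))"

text \<open>
  The series \<open>\<^sub>4f\<^sub>3\<close> with a tilde; both lists have length four. Gamma vanishes
  at its poles in the library, so the division gives the usual \<open>1/\<Gamma> = 0\<close> there.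
\<close>

definition f43 :: "complex list \<Rightarrow> complex list \<Rightarrow> complex \<Rightarrow> complex" where
  "f43 as bs x =
     (\<Sum>n. (\<Prod>a\<leftarrow>as. Gamma (a + of_nat n)) / (\<Prod>b\<leftarrow>bs. Gamma (b + of_nat n)) * x ^ n)"

text \<open>
  The parameters are \<open>\<alpha> 0, \<dots>, \<alpha> 3\<close> and \<open>\<beta> 1, \<beta> 2, \<beta> 3\<close>; only \<open>i \<le> 7\<close> is meaningful.
\<close>

definition y :: "nat \<Rightarrow> (nat \<Rightarrow> complex) \<Rightarrow> (nat \<Rightarrow> complex) \<Rightarrow> complex" where
  "y i \<alpha> \<beta> =
    (if i = 0 then
       f43 [\<alpha> 0, \<alpha> 1, \<alpha> 2, \<alpha> 3] [1, \<beta> 1, \<beta> 2, \<beta> 3] 1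
     else if i \<le> 3 then
       f43 [\<alpha> 0 + 1 - \<beta> i, \<alpha> 1 + 1 - \<beta> i, \<alpha> 2 + 1 - \<beta> i, \<alpha> 3 + 1 - \<beta> i]
           [2 - \<beta> i, \<beta> 1 + 1 - \<beta> i, \<beta> 2 + 1 - \<beta> i, \<beta> 3 + 1 - \<beta> i] 1
     else let j = i - 4 in
       - f43 [\<alpha> j, \<alpha> j + 1 - \<beta> 1, \<alpha> j + 1 - \<beta> 2, \<alpha> j + 1 - \<beta> 3]
             [\<alpha> j + 1 - \<alpha> 0, \<alpha> j + 1 - \<alpha> 1, \<alpha> j + 1 - \<alpha> 2, \<alpha> j + 1 - \<alpha> 3] 1)"

definition y_shift :: "nat \<Rightarrow> nat \<Rightarrow> (nat \<Rightarrow> complex) \<Rightarrow> (nat \<Rightarrow> complex) \<Rightarrow> complex" where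
  "y_shift i n \<alpha> \<beta> =
     y i (\<alpha>(0 := \<alpha> 0 - of_nat n, 1 := \<alpha> 1 - of_nat n))
         (\<beta>(1 := \<beta> 1 - of_nat n, 2 := \<beta> 2 - of_nat n))"

definition D1 :: "nat \<Rightarrow> nat \<Rightarrow> nat \<Rightarrow> (nat \<Rightarrow> complex) \<Rightarrow> (nat \<Rightarrow> complex) \<Rightarrow> complex" where
  "D1 i j n \<alpha> \<beta> = y_shift i n \<alpha> \<beta> - y_shift j n \<alpha> \<beta>"

text \<open>\<open>half_sum\<close> is the quantity \<open>A\<close> with four sign subscripts; the signs are passed as \<open>\<plusminus>1\<close>.\<close>

fun half_sum :: "params \<Rightarrow> complex \<Rightarrow> complex \<Rightarrow> complex \<Rightarrow> complex \<Rightarrow> complex" where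
  "half_sum (A0, A1, A2, A3) e0 e1 e2 e3 = (e0 * A0 + e1 * A1 + e2 * A2 + e3 * A3 + 1) / 2"

fun alpha_par :: "nat \<Rightarrow> params \<Rightarrow> nat \<Rightarrow> complex" where
  "alpha_par k (A0, A1, A2, A3) m =
    (let h = half_sum (A0, A1, A2, A3) in
     (if k = 1 then [1/2, A0 + 1/2, h 1 (-1) (-1) (-1), h 1 (-1) 1 1]
      else if k = 2 then [1/2, A2 + 1/2, h (-1) (-1) 1 (-1), h 1 (-1) 1 1]
      else if k = 3 then [A0 + 1/2, A2 + 1/2, h 1 (-1) 1 1, h 1 (-1) 1 (-1)]
      else [A2 + 1/2, A3 + 1/2, h 1 (-1) 1 1, h (-1) (-1) 1 1]) ! m)"

fun beta_par :: "nat \<Rightarrow> params \<Rightarrow> nat \<Rightarrow> complex" where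
  "beta_par k (A0, A1, A2, A3) m =
    (let h = half_sum (A0, A1, A2, A3) in
     (if k = 1 then [h 1 (-1) (-1) 1 + 1/2, h 1 (-1) 1 (-1) + 1/2, A0 + 1]
      else if k = 2 then [h (-1) (-1) 1 1 + 1/2, h 1 (-1) 1 (-1) + 1/2, A2 + 1]
      else if k = 3 then [h 1 (-1) 1 1 + 1/2, h 1 (-1) 1 (-1) + 1/2, A0 + A2 + 1]
      else [h 1 (-1) 1 1 + 1/2, h (-1) (-1) 1 1 + 1/2, A2 + A3 + 1]) ! (m - 1))"

fun lam :: "nat \<Rightarrow> params \<Rightarrow> nat \<Rightarrow> complex" where
  "lam k (A0, A1, A2, A3) n =
    (let q = (\<lambda>a. pochhammer (1/2 - a) n * pochhammer (1/2 + a) n) in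
     (if k = 1 then pochhammer (1/2) n / fact n
      else if k = 2 then pochhammer (1/2) n * q A2 / (fact n * q A0)
      else if k = 3 then q A2 / (fact n * pochhammer (1/2) n)
      else q A2 * q A3 / (fact n * pochhammer (1/2) n * q A0)))"

definition W1 :: "nat \<Rightarrow> nat \<Rightarrow> nat \<Rightarrow> params \<Rightarrow> nat \<Rightarrow> complex" where
  "W1 k i j A n = lam k A n * D1 i j n (alpha_par k A) (beta_par k A)"

fun p0 :: "params \<Rightarrow> complex \<Rightarrow> complex" where
  "p0 (A0, A1, A2, A3) x = x^3 * (x - 1)^2"

fun p1 :: "params \<Rightarrow> complex \<Rightarrow> complex" where
  "p1 (A0, A1, A2, A3) x = - 2 * x^2 * (x - 1) * (2 * A0 * x - 2 * A0 - 5 * x + 3)"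

fun p2 :: "params \<Rightarrow> complex \<Rightarrow> complex" where
  "p2 (A0, A1, A2, A3) x =
     x * ((6 * A0^2 - A2^2 - A3^2 - 24 * A0 + 25) * x^2
        + (- 11 * A0^2 - A1^2 + A2^2 + A3^2 + 36 * A0 - 59/2) * x
        + 1/4 * (10 * A0 - 9) * (2 * A0 - 3))"

fun p3 :: "params \<Rightarrow> complex \<Rightarrow> complex" where
  "p3 (A0, A1, A2, A3) x =
     - (2 * A0 - 3) * (2 * A0^2 - A2^2 - A3^2 - 6 * A0 + 5) * x^2
     + (A0 - 1) * (6 * A0^2 + 2 * A1^2 - 2 * A2^2 - 2 * A3^2 - 16 * A0 + 11) * x
     - 1/4 * (2 * A0 - 3) * (2 * A0 - 1)^2"

fun p4 :: "params \<Rightarrow> complex \<Rightarrow> complex" where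
  "p4 (A0, A1, A2, A3) x =
     (A0 - 1 + A3) * (A0 - 1 - A3) * (A0 - 1 + A2) * (A0 - 1 - A2) * x
     - 1/4 * (2 * A0 - 1)^2 * (A0^2 + A1^2 - A2^2 - A3^2 - 2 * A0 + 1)"

definition Z :: "params \<Rightarrow> (complex \<Rightarrow> complex) \<Rightarrow> complex \<Rightarrow> complex" where
  "Z A f x = p0 A x * (deriv ^^ 4) f x + p1 A x * (deriv ^^ 3) f x
           + p2 A x * (deriv ^^ 2) f x + p3 A x * deriv f x + p4 A x * f x"

definition frobenius_series :: "complex \<Rightarrow> (nat \<Rightarrow> complex) \<Rightarrow> complex \<Rightarrow> complex" where
  "frobenius_series \<rho> C x = x powr \<rho> * (\<Sum>n. C n * x ^ n)"

text \<open>
  The power series converges near 0, and on its disc of convergence, slit along the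
  nonpositive reals (the cut of the principal branch of \<open>x powr \<rho>\<close>), the Frobenius
  series is annihilated by \<open>Z A\<close>. Any other branch of the power is locally a constant
  multiple of the principal one.
\<close>

definition solution_at_0 :: "params \<Rightarrow> complex \<Rightarrow> (nat \<Rightarrow> complex) \<Rightarrow> bool" where
  "solution_at_0 A \<rho> C \<longleftrightarrow>
     conv_radius C > 0 \<and>
     (\<forall>x. x \<notin> \<real>\<^sub>\<le>\<^sub>0 \<and> ereal (norm x) < conv_radius C \<longrightarrow> Z A (frobenius_series \<rho> C) x = 0)"

end

theory Submission
  imports Defs
begin

text \<open>
  Let \<open>t(n, z)\<close> be the summand of \<open>y\<^sub>0(n; \<alpha>)\<close> as a function of a complex summation variable. The
  recurrence that \<open>Z(A)\<close> imposes on the coefficients becomes, after division by \<open>\<lambda>\<^sub>k(n)\<close>, a creative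
  telescoping relation \<open>c\<^sub>+ t(n + 1, z) + c\<^sub>0 t(n, z) + c\<^sub>- t(n - 1, z) = G(z + 1) - G(z)\<close>, where
  \<open>G(z) = r(z) q(z) t(n, z)\<close> with an explicit rational \<open>r\<close> and a quadratic polynomial \<open>q\<close>. All
  eight \<open>y\<^sub>i\<close> are sums of \<open>t\<close> (up to a periodic factor) over half-lines that begin at a zero of
  \<open>G\<close>. Since \<open>\<Sigma>\<beta> - \<Sigma>\<alpha> = 1\<close>, \<open>t(n, z)\<close> decays like \<open>z\<^sup>-\<^sup>2\<close> and \<open>G\<close> tends to the leading coefficient of
  \<open>q\<close>, which does not depend on \<open>i\<close>. So the differences \<open>y\<^sub>i - y\<^sub>j\<close> satisfy the homogeneous recurrence.
\<close>

section \<open>Quotients of Gamma functions\<close>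

text \<open>Each term x^j d^k of Z(A) has j - k in {-1, 0, 1}, so a Frobenius series is a solution
  exactly under a three-term recurrence of its coefficients. The factor \<open>lam k\<close> is what
  makes the coefficients of this recurrence proportional to those of a contiguity relation. The
  starting points of four of the eight sums move with n, whereas telescoping needs one common start
  for the three neighbouring values of n. The periodic factor, a quotient of sines from the
  reflection formula, is never formed: for downward sums the certificate itself is reflected, and
  the minus sign in the definition of y_4, ..., y_7 gives them the same limit as the others.
  Genericity means that no nontrivial integer combination of the A_i is an integer. It keeps the
  upper Gamma arguments off the poles and the leading coefficient of the recurrence nonzero. Lower
  Gamma arguments do meet poles, and the vanishing terms there are essential. The positive radius of
  convergence is read off the recurrence as well; no asymptotics of y_i(n) in n are
  required.\<close>

lemma Gamma_plus_of_nat_asymp: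
  fixes z :: complex
  shows "(\<lambda>n. Gamma (z + of_nat n) / (fact n * of_nat n powr (z - 1))) \<longlonglongrightarrow> 1"
proof -
  \<comment> \<open>Off the poles this is the limit formula behind \<open>Gamma_series'\<close>,
    rewritten with the Pochhammer symbol.\<close>
  have nonpole: "(\<lambda>n. Gamma (z + of_nat n) / (fact n * of_nat n powr (z - 1))) \<longlonglongrightarrow> 1"
      if z: "z \<notin> \<int>\<^sub>\<le>\<^sub>0" for z :: complex
  proof -
    have nz: "Gamma z \<noteq> 0"
      using z by (simp add: Gamma_eq_zero_iff)
    have "(\<lambda>n. Gamma z / Gamma_series' z n) \<longlonglongrightarrow> Gamma z / Gamma z"
      by (intro tendsto_intros Gamma_series'_LIMSEQ nz)
    hence "(\<lambda>n. Gamma z / Gamma_series' z n) \<longlonglongrightarrow> 1"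
      using nz by simp
    moreover have "eventually (\<lambda>n. Gamma z / Gamma_series' z n =
        Gamma (z + of_nat n) / (fact n * of_nat n powr (z - 1))) sequentially"
      using eventually_gt_at_top[of 0]
    proof eventually_elim
      case (elim n)
      then obtain m where m: "n = Suc m" by (cases n) auto
      have f: "fact n = of_nat n * (fact (n - 1) :: complex)"
        using m by simp
      have p: "(of_nat n :: complex) powr z = of_nat n * of_nat n powr (z - 1)"
        using elim by (simp add: powr_diff)
      have e: "exp (z * of_real (ln (of_nat n))) = (of_nat n :: complex) powr z"
        using elim by (simp add: powr_def Ln_of_nat)
      have g: "Gamma (z + of_nat n) = pochhammer z n * Gamma z"
        using pochhammer_Gamma[OF z, of n] nz by simp
      show ?case
        unfolding Gamma_series'_def e p f g by (simp add: field_simps)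
    qed
    ultimately show ?thesis
      by (rule Lim_transform_eventually)
  qed
  \<comment> \<open>The functional equation carries the limit from z + 1 to z. Induction thus
    reaches the nonpositive integers, where finitely many Gamma (z + n) have the default value 0.
    These occur among the lower parameters.\<close>
  have step: "(\<lambda>n. Gamma (z + of_nat n) / (fact n * of_nat n powr (z - 1))) \<longlonglongrightarrow> 1"
    if lim: "(\<lambda>n. Gamma (z + 1 + of_nat n) / (fact n * of_nat n powr (z + 1 - 1))) \<longlonglongrightarrow> 1"
        for z :: complex
  proof -
    have "(\<lambda>n. of_nat n / (z + of_nat n)) \<longlonglongrightarrow> 1"
    proof -
      have "(\<lambda>n. 1 / (z * inverse (of_nat n) + 1)) \<longlonglongrightarrow> 1 / (z * 0 + 1 :: complex)"
        by (intro tendsto_intros lim_inverse_n) auto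
      moreover have "eventually (\<lambda>n. 1 / (z * inverse (of_nat n) + 1) = of_nat n / (z + of_nat n))
          sequentially"
        using eventually_gt_at_top[of 0]
        by eventually_elim (simp add: divide_simps)
      ultimately show ?thesis
        by (auto intro: Lim_transform_eventually)
    qed
    from tendsto_mult[OF lim this]
    have "(\<lambda>n. Gamma (z + 1 + of_nat n) / (fact n * of_nat n powr (z + 1 - 1))
        * (of_nat n / (z + of_nat n))) \<longlonglongrightarrow> 1"
      by simp
    moreover have "eventually (\<lambda>n. Gamma (z + 1 + of_nat n) / (fact n * of_nat n powr (z + 1 - 1))
        * (of_nat n / (z + of_nat n))
        = Gamma (z + of_nat n) / (fact n * of_nat n powr (z - 1))) sequentially"
      using eventually_gt_at_top[of "nat \<lceil>norm z\<rceil>"]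
    proof eventually_elim
      case (elim n)
      hence n: "norm z < real n"
        by linarith
      have nonpole: "z + of_nat n \<notin> \<int>\<^sub>\<le>\<^sub>0"
      proof
        assume "z + of_nat n \<in> \<int>\<^sub>\<le>\<^sub>0"
        hence "Re z + real n \<le> 0"
          by (auto elim!: nonpos_Ints_cases simp: complex_eq_iff)
        thus False
          using n abs_Re_le_cmod[of z] by linarith
      qed
      then have "z + of_nat n \<noteq> 0"
        by auto
      have "n > 0"
        using n norm_ge_zero[of z] by (cases n) auto
      have p: "of_nat n powr (z + 1 - 1) = of_nat n * (of_nat n :: complex) powr (z - 1)"
        using \<open>n > 0\<close> by (simp add: powr_diff)
      have "z + 1 + of_nat n = z + of_nat n + 1"
        by simp
      hence g: "Gamma (z + 1 + of_nat n) = (z + of_nat n) * Gamma (z + of_nat n)"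
        using Gamma_plus1[OF nonpole] by metis
      have cancel: "w * g / (f * (k * q)) * (k / w) = g / (f * q)" if "w \<noteq> 0" "k \<noteq> 0"
          for w g f k q :: complex
        using that by (simp add: field_simps)
      show ?case
        unfolding p g by (rule cancel) (use \<open>z + of_nat n \<noteq> 0\<close> \<open>n > 0\<close> in simp_all)
    qed
    ultimately show ?thesis
      by (rule Lim_transform_eventually)
  qed
  show ?thesis
  proof (cases "z \<in> \<int>\<^sub>\<le>\<^sub>0")
    case False
    thus ?thesis by (rule nonpole)
  next
    case True
    then obtain k where "z = - of_nat k"
      by (elim nonpos_Ints_cases')
    thus ?thesis
    proof (induction k arbitrary: z)
      case 0
      show ?case
        by (rule step, rule nonpole) (simp add: 0)
    next
      case (Suc k)
      show ?case
        by (rule step, rule Suc.IH) (simp add: Suc.prems)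
    qed
  qed
qed

definition gamma_quot :: "complex list \<Rightarrow> complex list \<Rightarrow> nat \<Rightarrow> complex" where
  "gamma_quot as bs n = (\<Prod>a\<leftarrow>as. Gamma (a + of_nat n)) / (\<Prod>b\<leftarrow>bs. Gamma (b + of_nat n))"

lemma f43_1: "f43 as bs 1 = suminf (gamma_quot as bs)"
  by (simp add: f43_def gamma_quot_def[abs_def])

text \<open>Each upper parameter is paired with a lower one, so the factorials of the Gamma
  asymptotics cancel and only the power n^(a - b) of each pair survives.\<close>

lemma gamma_quot_asymp:
  assumes "length as = length bs"
  shows "(\<lambda>n. gamma_quot as bs n * of_nat n powr (sum_list bs - sum_list as)) \<longlonglongrightarrow> 1"
  using assms
proof (induction as bs rule: list_induct2)
  case Nil
  have "eventually (\<lambda>n. 1 = gamma_quot [] [] n * of_nat n powr (sum_list [] - sum_list []))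
      sequentially"
    using eventually_gt_at_top[of 0] by eventually_elim (simp add: gamma_quot_def)
  thus ?case
    by (auto intro: Lim_transform_eventually)
next
  case (Cons a as b bs)
  have "(\<lambda>n. gamma_quot as bs n * of_nat n powr (sum_list bs - sum_list as) *
      ((Gamma (a + of_nat n) / (fact n * of_nat n powr (a - 1))) /
       (Gamma (b + of_nat n) / (fact n * of_nat n powr (b - 1))))) \<longlonglongrightarrow> 1 * (1 / 1)"
    by (intro tendsto_mult tendsto_divide Cons.IH Gamma_plus_of_nat_asymp) auto
  moreover have "eventually (\<lambda>n. gamma_quot as bs n * of_nat n powr (sum_list bs - sum_list as) *
      ((Gamma (a + of_nat n) / (fact n * of_nat n powr (a - 1))) /
       (Gamma (b + of_nat n) / (fact n * of_nat n powr (b - 1)))) =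
      gamma_quot (a # as) (b # bs) n * of_nat n powr (sum_list (b # bs) - sum_list (a # as)))
          sequentially"
    using eventually_gt_at_top[of 0]
    by eventually_elim (simp add: gamma_quot_def powr_diff powr_add mult_ac)
  ultimately show ?case
    by (auto intro: Lim_transform_eventually)
qed

lemma gamma_quot_asymp2:
  assumes "length as = length bs" "sum_list bs - sum_list as = 2"
  shows "(\<lambda>n. gamma_quot as bs n * of_nat n ^ 2) \<longlonglongrightarrow> 1"
proof -
  have "eventually (\<lambda>n. gamma_quot as bs n * of_nat n powr (sum_list bs - sum_list as)
      = gamma_quot as bs n * of_nat n ^ 2) sequentially"
    using eventually_gt_at_top[of 0]
    by eventually_elim (simp add: assms(2) flip: powr_nat)
  with gamma_quot_asymp[OF assms(1)] show ?thesis
    by (rule Lim_transform_eventually)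
qed

lemma summable_gamma_quot:
  assumes "length as = length bs" "sum_list bs - sum_list as = 2"
  shows "summable (gamma_quot as bs)"
proof -
  obtain K where K: "\<And>n. norm (gamma_quot as bs n * of_nat n ^ 2) \<le> K"
    using convergent_imp_Bseq[OF convergentI[OF gamma_quot_asymp2[OF assms]]]
    by (auto elim!: BseqE)
  show ?thesis
  proof (rule summable_comparison_test')
    show "summable (\<lambda>n. K * inverse (real n ^ 2))"
      by (intro summable_mult inverse_power_summable) simp
    show "norm (gamma_quot as bs n) \<le> K * inverse (real n ^ 2)" if "n \<ge> 1" for n
      using K[of n] that by (simp add: norm_mult norm_power field_simps)
  qed
qed

text \<open>Since \<open>Gamma b = 0\<close> and division by zero gives 0, the term of index 0
  vanishes just as 1/Gamma demands. Dropping it is the same as raising all parameters by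
  one.\<close>

lemma f43_shift:
  assumes "length as = length bs" "sum_list bs - sum_list as = 2" "b \<in> set bs" "b \<in> \<int>\<^sub>\<le>\<^sub>0"
  shows "f43 as bs 1 = f43 (map (\<lambda>a. a + 1) as) (map (\<lambda>b. b + 1) bs) 1"
proof -
  have "Gamma b = 0"
    using assms(4) by (simp add: Gamma_eq_zero_iff)
  hence "gamma_quot as bs 0 = 0"
    using imageI[OF assms(3), of Gamma] by (simp add: gamma_quot_def prod_list_zero_iff)
  moreover have "gamma_quot as bs (Suc n) = gamma_quot (map (\<lambda>a. a + 1) as) (map (\<lambda>b. b + 1) bs) n"
      for n
    by (simp add: gamma_quot_def o_def add_ac)
  ultimately show ?thesis
    using suminf_split_head[OF summable_gamma_quot[OF assms(1,2)]] by (simp add: f43_1)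
qed

section \<open>Telescoping sums\<close>

lemma quadratic_over_square_limit:
  fixes q0 q1 q2 w :: complex
  shows "(\<lambda>m. (q0 + q1 * (w + of_nat m) + q2 * (w + of_nat m)^2) / of_nat m ^ 2) \<longlonglongrightarrow> q2"
proof -
  have "(\<lambda>m. q0 * inverse (of_nat m) ^ 2 + q1 * (w * inverse (of_nat m) ^ 2 + inverse (of_nat m))
      + q2 * (w * inverse (of_nat m) + 1) ^ 2) \<longlonglongrightarrow> q0 * 0 ^ 2 + q1 * (w * 0 ^ 2 + 0) + q2 * (w * 0
          + 1) ^ 2"
    by (intro tendsto_intros lim_inverse_n)
  moreover have "eventually (\<lambda>m. q0 * inverse (of_nat m) ^ 2
      + q1 * (w * inverse (of_nat m) ^ 2 + inverse (of_nat m))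
      + q2 * (w * inverse (of_nat m) + 1) ^ 2
      = (q0 + q1 * (w + of_nat m) + q2 * (w + of_nat m)^2) / of_nat m ^ 2) sequentially"
    using eventually_gt_at_top[of 0]
    by eventually_elim (simp add: field_simps power2_eq_square)
  ultimately show ?thesis
    by (auto intro: Lim_transform_eventually)
qed

lemma Gamma_plus_of_nat_plus1:
  "a \<notin> \<int>\<^sub>\<le>\<^sub>0 \<Longrightarrow> Gamma (a + of_nat m + 1) = (a + of_nat m) * Gamma (a + of_nat m :: complex)"
  by (rule Gamma_plus1) (use nonpos_Ints_diff_Nats[of "a + of_nat m" "of_nat m"] in auto)

text \<open>The balance condition gives the three summands and the auxiliary quotient
  \<open>v\<close> the decay m^(-2). Hence \<open>v m * Q m\<close> tends to L, while
  \<open>zero\<close> removes the boundary term at m = 0. Only the quadratic growth of Q enters, so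
  Q can be a quadratic read upwards or downwards.\<close>

lemma contiguous_sum:
  fixes a0 a1 a2 a3 b0 b1 b2 b3 cp c0 cm L :: complex and Q :: "nat \<Rightarrow> complex"
  assumes bal: "b0 + b1 + b2 + b3 = a0 + a1 + a2 + a3 + 2"
    and zero: "b0 = 1 \<or> b1 = 0 \<or> b2 = 0 \<or> b3 = 1"
    and poles: "a0 - 1 \<notin> \<int>\<^sub>\<le>\<^sub>0" "a1 - 1 \<notin> \<int>\<^sub>\<le>\<^sub>0" "a2 \<notin> \<int>\<^sub>\<le>\<^sub>0" "a3 \<notin> \<int>\<^sub>\<le>\<^sub>0"
    and lim: "(\<lambda>m. Q m / of_nat m ^ 2) \<longlonglongrightarrow> L"
    and certificate: "\<And>m. cp * ((b1 + of_nat m - 1) * (b1 + of_nat m) * (b2 + of_nat m - 1)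
        * (b2 + of_nat m))
        + c0 * ((a0 + of_nat m - 1) * (a1 + of_nat m - 1) * (b1 + of_nat m) * (b2 + of_nat m))
        + cm * ((a0 + of_nat m - 1) * (a0 + of_nat m) * (a1 + of_nat m - 1) * (a1 + of_nat m))
      = (a0 + of_nat m - 1) * (a1 + of_nat m - 1) * (a2 + of_nat m) * (a3 + of_nat m) * Q (Suc m)
        - (b0 + of_nat m - 1) * (b1 + of_nat m) * (b2 + of_nat m) * (b3 + of_nat m - 1) * Q m"
  shows "cp * f43 [a0 - 1, a1 - 1, a2, a3] [b0, b1 - 1, b2 - 1, b3] 1
    + c0 * f43 [a0, a1, a2, a3] [b0, b1, b2, b3] 1
    + cm * f43 [a0 + 1, a1 + 1, a2, a3] [b0, b1 + 1, b2 + 1, b3] 1 = L"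
proof -
  let ?Tp = "gamma_quot [a0 - 1, a1 - 1, a2, a3] [b0, b1 - 1, b2 - 1, b3]"
  let ?T0 = "gamma_quot [a0, a1, a2, a3] [b0, b1, b2, b3]"
  let ?Tm = "gamma_quot [a0 + 1, a1 + 1, a2, a3] [b0, b1 + 1, b2 + 1, b3]"
  \<comment> \<open>This is the product r t of the overview: the rational factor is absorbed by
    moving Gamma arguments by one.\<close>
  define v where "v = gamma_quot [a0 - 1, a1 - 1, a2, a3] [b0 - 1, b1, b2, b3 - 1]"
  have telescope: "cp * ?Tp m + c0 * ?T0 m + cm * ?Tm m = v (Suc m) * Q (Suc m) - v m * Q m" for m
  proof -
    let ?m = "of_nat m :: complex"
    define A0 where "A0 = Gamma (a0 + ?m - 1)"
    define A1 where "A1 = Gamma (a1 + ?m - 1)"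
    define A2 where "A2 = Gamma (a2 + ?m)"
    define A3 where "A3 = Gamma (a3 + ?m)"
    define B0 where "B0 = rGamma (b0 + ?m)"
    define B1 where "B1 = rGamma (b1 + ?m + 1)"
    define B2 where "B2 = rGamma (b2 + ?m + 1)"
    define B3 where "B3 = rGamma (b3 + ?m)"
    \<comment> \<open>U has the smallest argument of each upper Gamma and the largest of each lower
      one, so all five terms of the relation are U times a polynomial in m.\<close>
    define U where "U = A0 * A1 * A2 * A3 * (B0 * B1 * B2 * B3)"
    have shift: "x - 1 + ?m = x + ?m - 1" "x + 1 + ?m = x + ?m + 1"
      "x - 1 + of_nat (Suc m) = x + ?m" "x + of_nat (Suc m) = x + ?m + 1" for x :: complex
      by simp_all
    have A0: "Gamma (a0 + ?m) = (a0 + ?m - 1) * A0"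
      using Gamma_plus_of_nat_plus1[OF poles(1), of m] unfolding shift A0_def by simp
    have A0': "Gamma (a0 + ?m + 1) = (a0 + ?m) * ((a0 + ?m - 1) * A0)"
      using Gamma_plus_of_nat_plus1[OF poles(1), of "Suc m"] unfolding shift diff_add_cancel A0 .
    have A1: "Gamma (a1 + ?m) = (a1 + ?m - 1) * A1"
      using Gamma_plus_of_nat_plus1[OF poles(2), of m] unfolding shift A1_def by simp
    have A1': "Gamma (a1 + ?m + 1) = (a1 + ?m) * ((a1 + ?m - 1) * A1)"
      using Gamma_plus_of_nat_plus1[OF poles(2), of "Suc m"] unfolding shift diff_add_cancel A1 .
    have A2: "Gamma (a2 + ?m + 1) = (a2 + ?m) * A2"
      using Gamma_plus_of_nat_plus1[OF poles(3), of m] by (simp add: A2_def)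
    have A3: "Gamma (a3 + ?m + 1) = (a3 + ?m) * A3"
      using Gamma_plus_of_nat_plus1[OF poles(4), of m] by (simp add: A3_def)
    \<comment> \<open>For the reciprocal Gamma function the functional equation holds everywhere,
      including the poles at which a lower parameter starts.\<close>
    have B0: "rGamma (b0 + ?m - 1) = (b0 + ?m - 1) * B0"
      using rGamma_plus1[of "b0 + ?m - 1"] by (simp add: B0_def)
    have B1: "rGamma (b1 + ?m) = (b1 + ?m) * B1"
      using rGamma_plus1[of "b1 + ?m"] by (simp add: B1_def)
    have B1': "rGamma (b1 + ?m - 1) = (b1 + ?m - 1) * ((b1 + ?m) * B1)"
      using rGamma_plus1[of "b1 + ?m - 1"] by (simp add: B1)
    have B2: "rGamma (b2 + ?m) = (b2 + ?m) * B2"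
      using rGamma_plus1[of "b2 + ?m"] by (simp add: B2_def)
    have B2': "rGamma (b2 + ?m - 1) = (b2 + ?m - 1) * ((b2 + ?m) * B2)"
      using rGamma_plus1[of "b2 + ?m - 1"] by (simp add: B2)
    have B3: "rGamma (b3 + ?m - 1) = (b3 + ?m - 1) * B3"
      using rGamma_plus1[of "b3 + ?m - 1"] by (simp add: B3_def)
    have quot: "gamma_quot [x0, x1, x2, x3] [y0, y1, y2, y3] n =
        Gamma (x0 + of_nat n) * Gamma (x1 + of_nat n) * Gamma (x2 + of_nat n)
            * Gamma (x3 + of_nat n)
        * (rGamma (y0 + of_nat n) * rGamma (y1 + of_nat n) * rGamma (y2 + of_nat n)
            * rGamma (y3 + of_nat n))"
      for x0 x1 x2 x3 y0 y1 y2 y3 n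
      by (simp add: gamma_quot_def rGamma_inverse_Gamma divide_inverse mult_ac)
    have Tp: "?Tp m = U * ((b1 + ?m - 1) * (b1 + ?m) * (b2 + ?m - 1) * (b2 + ?m))"
      unfolding quot shift B1' B2' unfolding U_def A0_def A1_def A2_def A3_def B0_def B3_def
      by (simp only: mult_ac)
    have T0: "?T0 m = U * ((a0 + ?m - 1) * (a1 + ?m - 1) * (b1 + ?m) * (b2 + ?m))"
      unfolding quot shift A0 A1 B1 B2 unfolding U_def A2_def A3_def B0_def B3_def
      by (simp only: mult_ac)
    have Tm: "?Tm m = U * ((a0 + ?m - 1) * (a0 + ?m) * (a1 + ?m - 1) * (a1 + ?m))"
      unfolding quot shift A0' A1' unfolding U_def A2_def A3_def B0_def B1_def B2_def B3_def
      by (simp only: mult_ac)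
    have v0: "v m = U * ((b0 + ?m - 1) * (b1 + ?m) * (b2 + ?m) * (b3 + ?m - 1))"
      unfolding v_def quot shift B0 B1 B2 B3 unfolding U_def A0_def A1_def A2_def A3_def
      by (simp only: mult_ac)
    have v1: "v (Suc m) = U * ((a0 + ?m - 1) * (a1 + ?m - 1) * (a2 + ?m) * (a3 + ?m))"
      unfolding v_def quot shift diff_add_cancel A0 A1 A2 A3
          unfolding U_def B0_def B1_def B2_def B3_def
      by (simp only: mult_ac)
    have "cp * ?Tp m + c0 * ?T0 m + cm * ?Tm m =
        U * (cp * ((b1 + ?m - 1) * (b1 + ?m) * (b2 + ?m - 1) * (b2 + ?m))
          + c0 * ((a0 + ?m - 1) * (a1 + ?m - 1) * (b1 + ?m) * (b2 + ?m))
          + cm * ((a0 + ?m - 1) * (a0 + ?m) * (a1 + ?m - 1) * (a1 + ?m)))"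
      unfolding Tp T0 Tm distrib_left by (simp only: mult_ac)
    also have "\<dots> = v (Suc m) * Q (Suc m) - v m * Q m"
      unfolding certificate v0 v1 right_diff_distrib[of U] by (simp only: mult_ac)
    finally show ?thesis .
  qed
  have "(\<lambda>m. (v m * of_nat m ^ 2) * (Q m / of_nat m ^ 2)) \<longlonglongrightarrow> 1 * L"
    unfolding v_def by (intro tendsto_mult gamma_quot_asymp2 lim)
        (use bal in \<open>auto simp: algebra_simps\<close>)
  moreover have "eventually (\<lambda>m. (v m * of_nat m ^ 2) * (Q m / of_nat m ^ 2)
      = v m * Q m) sequentially"
    using eventually_gt_at_top[of 0] by eventually_elim simp
  ultimately have "(\<lambda>m. v m * Q m) \<longlonglongrightarrow> L"
    by (auto intro: Lim_transform_eventually)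
  from telescope_sums[OF this]
  have "(\<lambda>m. cp * ?Tp m + c0 * ?T0 m + cm * ?Tm m) sums (L - v 0 * Q 0)"
    by (simp only: telescope)
  moreover have "v 0 = 0"
    using zero by (auto simp: v_def gamma_quot_def Gamma_eq_zero_iff)
  moreover have "(\<lambda>m. cp * ?Tp m + c0 * ?T0 m + cm * ?Tm m) sums
      (cp * suminf ?Tp + c0 * suminf ?T0 + cm * suminf ?Tm)"
    by (intro sums_add sums_mult summable_sums summable_gamma_quot)
        (use bal in \<open>auto simp: algebra_simps\<close>)
  ultimately show ?thesis
    unfolding f43_1 by (simp add: sums_iff)
qed

text \<open>The summation variable is z = w + m, so one polynomial certificate in z serves every
  starting point. The four values of w are the points where one of the reciprocal Gamma factors of
  \<open>v\<close>, with arguments z, \<beta> 1 + z, \<beta> 2 + z and \<beta> 3 + z - 1, has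
  argument 0.\<close>

lemma contiguous_forward:
  fixes \<alpha> \<beta> :: "nat \<Rightarrow> complex"
  assumes bal: "\<beta> 1 + \<beta> 2 + \<beta> 3 = \<alpha> 0 + \<alpha> 1 + \<alpha> 2 + \<alpha> 3 + 1"
    and zero: "w = 0 \<or> w = - \<beta> 1 \<or> w = - \<beta> 2 \<or> w = 1 - \<beta> 3"
    and poles: "\<alpha> 0 + w - 1 \<notin> \<int>\<^sub>\<le>\<^sub>0" "\<alpha> 1 + w - 1 \<notin> \<int>\<^sub>\<le>\<^sub>0" "\<alpha> 2 + w \<notin> \<int>\<^sub>\<le>\<^sub>0" "\<alpha> 3 + w \<notin> \<int>\<^sub>\<le>\<^sub>0"
    and certificate: "\<And>z. cp * ((\<beta> 1 + z - 1) * (\<beta> 1 + z) * (\<beta> 2 + z - 1) * (\<beta> 2 + z))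
        + c0 * ((\<alpha> 0 + z - 1) * (\<alpha> 1 + z - 1) * (\<beta> 1 + z) * (\<beta> 2 + z))
        + cm * ((\<alpha> 0 + z - 1) * (\<alpha> 0 + z) * (\<alpha> 1 + z - 1) * (\<alpha> 1 + z))
      = (\<alpha> 0 + z - 1) * (\<alpha> 1 + z - 1) * (\<alpha> 2 + z) * (\<alpha> 3 + z) * (q0 + q1 * (z + 1) + q2 * (z + 1)^2)
        - z * (\<beta> 1 + z) * (\<beta> 2 + z) * (\<beta> 3 + z - 1) * (q0 + q1 * z + q2 * z^2)"
  shows "cp * f43 [\<alpha> 0 + w - 1, \<alpha> 1 + w - 1, \<alpha> 2 + w, \<alpha> 3 + w] [1 + w, \<beta> 1 + w - 1, \<beta> 2 + w - 1,
      \<beta> 3 + w] 1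
    + c0 * f43 [\<alpha> 0 + w, \<alpha> 1 + w, \<alpha> 2 + w, \<alpha> 3 + w] [1 + w, \<beta> 1 + w, \<beta> 2 + w, \<beta> 3 + w] 1
    + cm * f43 [\<alpha> 0 + w + 1, \<alpha> 1 + w + 1, \<alpha> 2 + w, \<alpha> 3 + w] [1 + w, \<beta> 1 + w + 1, \<beta> 2 + w + 1,
        \<beta> 3 + w] 1 = q2"
proof (rule contiguous_sum[where Q = "\<lambda>m. q0 + q1 * (w + of_nat m) + q2 * (w + of_nat m)^2"])
  show "1 + w + (\<beta> 1 + w) + (\<beta> 2 + w) + (\<beta> 3 + w) = \<alpha> 0 + w + (\<alpha> 1 + w) + (\<alpha> 2 + w) + (\<alpha> 3 + w) + 2"
    using bal by algebra
  show "1 + w = 1 \<or> \<beta> 1 + w = 0 \<or> \<beta> 2 + w = 0 \<or> \<beta> 3 + w = 1"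
    using zero by auto
  show "(\<lambda>m. (q0 + q1 * (w + of_nat m) + q2 * (w + of_nat m)^2) / of_nat m ^ 2) \<longlonglongrightarrow> q2"
    by (rule quadratic_over_square_limit)
  fix m
  have *: "w + of_nat (Suc m) = w + of_nat m + 1" "1 + w + of_nat m - 1 = w + of_nat m"
    by simp_all
  show "cp * ((\<beta> 1 + w + of_nat m - 1) * (\<beta> 1 + w + of_nat m) * (\<beta> 2 + w + of_nat m - 1)
      * (\<beta> 2 + w + of_nat m))
        + c0 * ((\<alpha> 0 + w + of_nat m - 1) * (\<alpha> 1 + w + of_nat m - 1) * (\<beta> 1 + w + of_nat m)
            * (\<beta> 2 + w + of_nat m))
        + cm * ((\<alpha> 0 + w + of_nat m - 1) * (\<alpha> 0 + w + of_nat m) * (\<alpha> 1 + w + of_nat m - 1)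
            * (\<alpha> 1 + w + of_nat m))
      = (\<alpha> 0 + w + of_nat m - 1) * (\<alpha> 1 + w + of_nat m - 1) * (\<alpha> 2 + w + of_nat m)
          * (\<alpha> 3 + w + of_nat m)
          * (q0 + q1 * (w + of_nat (Suc m)) + q2 * (w + of_nat (Suc m))^2)
        - (1 + w + of_nat m - 1) * (\<beta> 1 + w + of_nat m) * (\<beta> 2 + w + of_nat m)
            * (\<beta> 3 + w + of_nat m - 1)
          * (q0 + q1 * (w + of_nat m) + q2 * (w + of_nat m)^2)"
    using certificate[of "w + of_nat m"] unfolding * add.assoc[symmetric] .
qed (use poles in auto)

text \<open>
  Under \<open>z \<mapsto> -z\<close> the certificate turns into one for the parameters \<open>w + 1 - \<beta>\<close> over
  \<open>w + 1 - \<alpha>\<close>, in which raising and lowering are exchanged and \<open>q\<close> changes its sign.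
\<close>

lemma contiguous_backward:
  fixes \<alpha> \<beta> :: "nat \<Rightarrow> complex"
  assumes bal: "\<beta> 1 + \<beta> 2 + \<beta> 3 = \<alpha> 0 + \<alpha> 1 + \<alpha> 2 + \<alpha> 3 + 1"
    and zero: "w = \<alpha> 2 \<or> w = \<alpha> 0 - 1 \<or> w = \<alpha> 1 - 1 \<or> w = \<alpha> 3"
    and poles: "w - \<beta> 1 \<notin> \<int>\<^sub>\<le>\<^sub>0" "w - \<beta> 2 \<notin> \<int>\<^sub>\<le>\<^sub>0" "w \<notin> \<int>\<^sub>\<le>\<^sub>0" "w + 1 - \<beta> 3 \<notin> \<int>\<^sub>\<le>\<^sub>0"
    and certificate: "\<And>z. cp * ((\<beta> 1 + z - 1) * (\<beta> 1 + z) * (\<beta> 2 + z - 1) * (\<beta> 2 + z))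
        + c0 * ((\<alpha> 0 + z - 1) * (\<alpha> 1 + z - 1) * (\<beta> 1 + z) * (\<beta> 2 + z))
        + cm * ((\<alpha> 0 + z - 1) * (\<alpha> 0 + z) * (\<alpha> 1 + z - 1) * (\<alpha> 1 + z))
      = (\<alpha> 0 + z - 1) * (\<alpha> 1 + z - 1) * (\<alpha> 2 + z) * (\<alpha> 3 + z) * (q0 + q1 * (z + 1) + q2 * (z + 1)^2)
        - z * (\<beta> 1 + z) * (\<beta> 2 + z) * (\<beta> 3 + z - 1) * (q0 + q1 * z + q2 * z^2)"
  shows "cp * - f43 [w, w + 2 - \<beta> 1, w + 2 - \<beta> 2, w + 1 - \<beta> 3] [w + 2 - \<alpha> 0, w + 2 - \<alpha> 1,
      w + 1 - \<alpha> 2, w + 1 - \<alpha> 3] 1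
    + c0 * - f43 [w, w + 1 - \<beta> 1, w + 1 - \<beta> 2, w + 1 - \<beta> 3] [w + 1 - \<alpha> 0, w + 1 - \<alpha> 1, w + 1 - \<alpha> 2,
        w + 1 - \<alpha> 3] 1
    + cm * - f43 [w, w - \<beta> 1, w - \<beta> 2, w + 1 - \<beta> 3] [w - \<alpha> 0, w - \<alpha> 1, w + 1 - \<alpha> 2, w + 1 - \<alpha> 3] 1
        = q2"
proof -
  \<comment> \<open>The pairs moved by n trade places: \<beta> 1, \<beta> 2 now feed the shifted
    upper parameters and \<alpha> 0, \<alpha> 1 the lower ones. This dictates the order of the
    lists, which \<open>perm\<close> undoes.\<close>
  have "cm * f43 [w + 1 - \<beta> 1 - 1, w + 1 - \<beta> 2 - 1, w, w + 1 - \<beta> 3] [w + 1 - \<alpha> 2, w + 1 - \<alpha> 0 - 1,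
      w + 1 - \<alpha> 1 - 1, w + 1 - \<alpha> 3] 1
    + c0 * f43 [w + 1 - \<beta> 1, w + 1 - \<beta> 2, w, w + 1 - \<beta> 3] [w + 1 - \<alpha> 2, w + 1 - \<alpha> 0, w + 1 - \<alpha> 1,
        w + 1 - \<alpha> 3] 1
    + cp * f43 [w + 1 - \<beta> 1 + 1, w + 1 - \<beta> 2 + 1, w, w + 1 - \<beta> 3] [w + 1 - \<alpha> 2, w + 1 - \<alpha> 0 + 1,
        w + 1 - \<alpha> 1 + 1, w + 1 - \<alpha> 3] 1
    = - q2"
  proof (rule contiguous_sum[where Q = "\<lambda>m. - q0 - q1 * (1 - w - of_nat m)
      - q2 * (1 - w - of_nat m)^2"])
    show "w + 1 - \<alpha> 2 + (w + 1 - \<alpha> 0) + (w + 1 - \<alpha> 1) + (w + 1 - \<alpha> 3) = w + 1 - \<beta> 1 + (w + 1 - \<beta> 2)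
        + w + (w + 1 - \<beta> 3) + 2"
      using bal by algebra
    show "w + 1 - \<alpha> 2 = 1 \<or> w + 1 - \<alpha> 0 = 0 \<or> w + 1 - \<alpha> 1 = 0 \<or> w + 1 - \<alpha> 3 = 1"
      using zero by auto
    have "(\<lambda>m. (- q0 - q1 + (q1 + 2 * q2) * (w + of_nat m) - q2 + - q2 * (w + of_nat m)^2)
        / of_nat m ^ 2) \<longlonglongrightarrow> - q2"
      using quadratic_over_square_limit[of "- q0 - q1 - q2" "q1 + 2 * q2" w "- q2"]
          by (simp add: algebra_simps)
    thus "(\<lambda>m. (- q0 - q1 * (1 - w - of_nat m) - q2 * (1 - w - of_nat m)^2) / of_nat m ^ 2) \<longlonglongrightarrow> - q2"
      by (simp add: algebra_simps power2_eq_square)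
    fix m
    show "cm * ((w + 1 - \<alpha> 0 + of_nat m - 1) * (w + 1 - \<alpha> 0 + of_nat m) * (w + 1 - \<alpha> 1 + of_nat m
        - 1) * (w + 1 - \<alpha> 1 + of_nat m))
        + c0 * ((w + 1 - \<beta> 1 + of_nat m - 1) * (w + 1 - \<beta> 2 + of_nat m - 1)
            * (w + 1 - \<alpha> 0 + of_nat m) * (w + 1 - \<alpha> 1 + of_nat m))
        + cp * ((w + 1 - \<beta> 1 + of_nat m - 1) * (w + 1 - \<beta> 1 + of_nat m) * (w + 1 - \<beta> 2 + of_nat m
            - 1) * (w + 1 - \<beta> 2 + of_nat m))
      = (w + 1 - \<beta> 1 + of_nat m - 1) * (w + 1 - \<beta> 2 + of_nat m - 1) * (w + of_nat m)
          * (w + 1 - \<beta> 3 + of_nat m)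
          * (- q0 - q1 * (1 - w - of_nat (Suc m)) - q2 * (1 - w - of_nat (Suc m))^2)
        - (w + 1 - \<alpha> 2 + of_nat m - 1) * (w + 1 - \<alpha> 0 + of_nat m) * (w + 1 - \<alpha> 1 + of_nat m)
            * (w + 1 - \<alpha> 3 + of_nat m - 1)
          * (- q0 - q1 * (1 - w - of_nat m) - q2 * (1 - w - of_nat m)^2)"
    proof -
      \<comment> \<open>Every product has four linear factors, so their signs cancel. The two terms
        of the telescoping difference change places, which produces the minus sign of q and the
        argument z + 1 in \<open>Q m\<close>.\<close>
      define z where "z = - (w + of_nat m)"
      have flip: "w + 1 - x + of_nat m = - (x + z - 1)" "- (x + z - 1) - 1 = - (x + z)"
        "w + of_nat m = - z" "1 - w - of_nat (Suc m) = z" "1 - w - of_nat m = z + 1"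
        "- q0 - q1 * x - q2 * x\<^sup>2 = - (q0 + q1 * x + q2 * x\<^sup>2)" for x
        by (simp_all add: z_def)
      show ?thesis
        unfolding flip using certificate[of z]
        by (simp only: minus_mult_minus mult_minus_left mult_minus_right minus_minus
            diff_minus_eq_add mult_ac add_ac diff_conv_add_uminus)
    qed
  qed (use poles in auto)
  moreover have perm: "f43 [a, b, c, d] [e, f, g, h] 1 = f43 [c, a, b, d] [f, g, e, h] 1"
      for a b c d e f g h
    by (simp add: f43_def mult_ac)
  ultimately show ?thesis
    unfolding perm[of "w + 1 - \<beta> 1 - 1"] perm[of "w + 1 - \<beta> 1"] perm[of "w + 1 - \<beta> 1 + 1"]
    by (simp add: algebra_simps) (simp add: algebra_simps eq_neg_iff_add_eq_0 neg_eq_iff_add_eq_0)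
qed

text \<open>
  The series \<open>y\<^sub>1\<close>, \<open>y\<^sub>2\<close>, \<open>y\<^sub>4\<close>, \<open>y\<^sub>5\<close> start at a point that moves with \<open>n\<close>. Prepending terms that vanish
  because of \<open>1/\<Gamma>\<close> brings the three shifted sums to a common starting point.
\<close>

lemma f43_shift4:
  assumes "b0 + b1 + b2 + b3 = a0 + a1 + a2 + a3 + 2"
    and "b0 \<in> \<int>\<^sub>\<le>\<^sub>0 \<or> b1 \<in> \<int>\<^sub>\<le>\<^sub>0 \<or> b2 \<in> \<int>\<^sub>\<le>\<^sub>0 \<or> b3 \<in> \<int>\<^sub>\<le>\<^sub>0"
  shows "f43 [a0, a1, a2, a3] [b0, b1, b2, b3] 1
    = f43 [a0 + 1, a1 + 1, a2 + 1, a3 + 1] [b0 + 1, b1 + 1, b2 + 1, b3 + 1] 1"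
  using f43_shift[of "[a0, a1, a2, a3]" "[b0, b1, b2, b3]"] assms
  by (auto simp: algebra_simps)

text \<open>The upward series are summed from w = 0, -\<beta> 1, -\<beta> 2, 1 - \<beta> 3, the
  downward ones from w = \<alpha> 0 - 1, \<alpha> 1 - 1, \<alpha> 2, \<alpha> 3. Up to integers
  every upper Gamma argument is some \<alpha> i or \<alpha> i - \<beta> j, so \<open>nonint\<close>
  keeps all of them off the poles.\<close>

lemma y_recurrence:
  fixes \<alpha> \<beta> :: "nat \<Rightarrow> complex"
  assumes bal: "\<beta> 1 + \<beta> 2 + \<beta> 3 = \<alpha> 0 + \<alpha> 1 + \<alpha> 2 + \<alpha> 3 + 1"
    and nonint: "\<And>i. i < 4 \<Longrightarrow> \<alpha> i \<notin> \<int>" "\<And>i j. i < 4 \<Longrightarrow> j \<in> {1..3} \<Longrightarrow> \<alpha> i - \<beta> j \<notin> \<int>"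
    and certificate: "\<And>z. cp * ((\<beta> 1 + z - 1) * (\<beta> 1 + z) * (\<beta> 2 + z - 1) * (\<beta> 2 + z))
        + c0 * ((\<alpha> 0 + z - 1) * (\<alpha> 1 + z - 1) * (\<beta> 1 + z) * (\<beta> 2 + z))
        + cm * ((\<alpha> 0 + z - 1) * (\<alpha> 0 + z) * (\<alpha> 1 + z - 1) * (\<alpha> 1 + z))
      = (\<alpha> 0 + z - 1) * (\<alpha> 1 + z - 1) * (\<alpha> 2 + z) * (\<alpha> 3 + z) * (q0 + q1 * (z + 1) + q2 * (z + 1)^2)
        - z * (\<beta> 1 + z) * (\<beta> 2 + z) * (\<beta> 3 + z - 1) * (q0 + q1 * z + q2 * z^2)"
    and i: "i \<le> 7"
  shows "cp * y i (\<alpha>(0 := \<alpha> 0 - 1, 1 := \<alpha> 1 - 1)) (\<beta>(1 := \<beta> 1 - 1, 2 := \<beta> 2 - 1))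
    + c0 * y i \<alpha> \<beta>
    + cm * y i (\<alpha>(0 := \<alpha> 0 + 1, 1 := \<alpha> 1 + 1)) (\<beta>(1 := \<beta> 1 + 1, 2 := \<beta> 2 + 1)) = q2"
    (is "cp * ?yp + c0 * _ + cm * ?ym = q2")
proof -
  have nonpole: "x \<notin> \<int>\<^sub>\<le>\<^sub>0" if "i < 4" "x - \<alpha> i \<in> \<int>" for i x
    using nonint(1)[OF that(1)] Ints_diff[OF nonpos_Ints_Int that(2)] by fastforce
  have nonpole': "x \<notin> \<int>\<^sub>\<le>\<^sub>0" if "i < 4" "j \<in> {1..3}" "x - (\<alpha> i - \<beta> j) \<in> \<int>" for i j x
    using nonint(2)[OF that(1,2)] Ints_diff[OF nonpos_Ints_Int that(3)] by fastforce
  note forward = contiguous_forward[OF bal _ _ _ _ _ certificate]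
  note backward = contiguous_backward[OF bal _ _ _ _ _ certificate]
  have bal': "\<beta> 3 = \<alpha> 0 + \<alpha> 1 + \<alpha> 2 + \<alpha> 3 + 1 - \<beta> 1 - \<beta> 2"
    using bal by (simp add: algebra_simps)
  consider "i = 0" | "i = 3" | "i \<in> {1, 2}" | "i = 6" | "i = 7" | "i \<in> {4, 5}"
    using i unfolding insert_iff empty_iff by linarith
  thus ?thesis
  proof cases
    assume i: "i = 0"
    show ?thesis
      using forward[of 0] nonpole[of 0 "\<alpha> 0 - 1"] nonpole[of 1 "\<alpha> 1 - 1"] nonpole[of 2
          "\<alpha> 2"] nonpole[of 3 "\<alpha> 3"]
      unfolding i y_def by simp
  next
    assume i: "i = 3"
    show ?thesis
      using forward[of "1 - \<beta> 3"] nonpole'[of 0 3 "\<alpha> 0 - \<beta> 3"] nonpole'[of 1 3 "\<alpha> 1 - \<beta> 3"]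
        nonpole'[of 2 3 "\<alpha> 2 + 1 - \<beta> 3"] nonpole'[of 3 3 "\<alpha> 3 + 1 - \<beta> 3"]
      unfolding i y_def by (simp add: algebra_simps)
  next
    assume i: "i \<in> {1, 2}"
    \<comment> \<open>\<open>F c m\<close> is the series with n raised by c, begun at z = m -
      \<beta> i. Its defining start is m = c + 1. For m <= c the lower parameter m - c is a
      nonpositive integer, so m may be lowered to the common value 0.\<close>
    define F where "F c m = f43 [\<alpha> 0 - \<beta> i - c + m, \<alpha> 1 - \<beta> i - c + m, \<alpha> 2 - \<beta> i + m, \<alpha> 3 - \<beta> i + m]
      [1 - \<beta> i + m, \<beta> 1 - \<beta> i - c + m, \<beta> 2 - \<beta> i - c + m, \<beta> 3 - \<beta> i + m] 1" for c m
    have shift: "F c m = F c (m + 1)" if "m - c \<in> \<int>\<^sub>\<le>\<^sub>0" for c m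
      unfolding F_def add.assoc[symmetric] by (rule f43_shift4) (use i that in \<open>auto simp: bal'\<close>)
    have "?yp = F 1 2" "y i \<alpha> \<beta> = F 0 1" "?ym = F (- 1) 0"
      using i by (auto simp: F_def y_def algebra_simps)
    moreover have "F 1 2 = F 1 0" "F 0 1 = F 0 0"
      using shift[of 0 1] shift[of 1 1] shift[of 0 0] by simp_all
    ultimately have "?yp = F 1 0" "y i \<alpha> \<beta> = F 0 0" "?ym = F (- 1) 0"
      by simp_all
    thus ?thesis
      using forward[of "- \<beta> i"] i nonpole'[of 0 i "\<alpha> 0 - \<beta> i - 1"] nonpole'[of 1 i "\<alpha> 1 - \<beta> i - 1"]
        nonpole'[of 2 i "\<alpha> 2 - \<beta> i"] nonpole'[of 3 i "\<alpha> 3 - \<beta> i"]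
      by (auto simp: F_def)
  next
    assume i: "i = 6"
    show ?thesis
      using backward[of "\<alpha> 2"] nonpole'[of 2 1 "\<alpha> 2 - \<beta> 1"] nonpole'[of 2 2 "\<alpha> 2 - \<beta> 2"]
        nonpole'[of 2 3 "\<alpha> 2 + 1 - \<beta> 3"] nonpole[of 2 "\<alpha> 2"]
      unfolding i y_def by (simp add: algebra_simps)
  next
    assume i: "i = 7"
    show ?thesis
      using backward[of "\<alpha> 3"] nonpole'[of 3 1 "\<alpha> 3 - \<beta> 1"] nonpole'[of 3 2 "\<alpha> 3 - \<beta> 2"]
        nonpole'[of 3 3 "\<alpha> 3 + 1 - \<beta> 3"] nonpole[of 3 "\<alpha> 3"]
      unfolding i y_def by (simp add: algebra_simps)
  next
    assume "i \<in> {4, 5}"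
    then obtain l where i: "i = l + 4" and l: "l \<in> {0, 1}"
      by auto
    \<comment> \<open>Here z = -(\<alpha> l - 1 + m), and c counts steps towards smaller n:
      \<open>F (- 1)\<close> belongs to the raised n and \<open>F 1\<close> to the lowered
      one.\<close>
    define F where "F c m = f43 [\<alpha> l - 1 + m, \<alpha> l - \<beta> 1 - c + m, \<alpha> l - \<beta> 2 - c + m, \<alpha> l - \<beta> 3 + m]
      [\<alpha> l - \<alpha> 0 - c + m, \<alpha> l - \<alpha> 1 - c + m, \<alpha> l - \<alpha> 2 + m, \<alpha> l - \<alpha> 3 + m] 1" for c m
    have shift: "F c m = F c (m + 1)" if "m - c \<in> \<int>\<^sub>\<le>\<^sub>0" for c m
      unfolding F_def add.assoc[symmetric] by (rule f43_shift4) (use l that in \<open>auto simp: bal'\<close>)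
    have "?yp = - F (- 1) 0" "y i \<alpha> \<beta> = - F 0 1" "?ym = - F 1 2"
      using l unfolding i by (auto simp: F_def y_def algebra_simps)
    moreover have "F 1 2 = F 1 0" "F 0 1 = F 0 0"
      using shift[of 0 1] shift[of 1 1] shift[of 0 0] by simp_all
    ultimately have "?yp = - F (- 1) 0" "y i \<alpha> \<beta> = - F 0 0" "?ym = - F 1 0"
      by simp_all
    thus ?thesis
      using backward[of "\<alpha> l - 1"] l nonpole'[of l 1 "\<alpha> l - 1 - \<beta> 1"] nonpole'[of l 2
          "\<alpha> l - 1 - \<beta> 2"]
        nonpole[of l "\<alpha> l - 1"] nonpole'[of l 3 "\<alpha> l - \<beta> 3"]
      by (auto simp: F_def algebra_simps)
  qed
qed

section \<open>Certificates\<close>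

text \<open>
  The polynomials \<open>q\<^sub>0\<close>, \<open>q\<^sub>1\<close>, \<open>q\<^sub>2\<close> below solve the linear system of Gosper's algorithm. Centring the
  summation variable at \<open>s = z + A\<^sub>0/2\<close> (for \<open>k = 1\<close>) and \<open>s = z + (A\<^sub>0 + A\<^sub>2)/2\<close> (for \<open>k = 3\<close>) pairs
  the Gamma arguments so that only the squares \<open>A\<close>, \<open>C\<close>, \<open>D\<close> of half sums occur. The cases \<open>k = 2\<close> and
  \<open>k = 4\<close> arise by exchanging \<open>A\<^sub>0\<close> with \<open>A\<^sub>2\<close> and with \<open>A\<^sub>3\<close>, respectively.
\<close>

lemma certificate_12:
  fixes A C D b n :: complex
  obtains q0 q1 q2 where "\<And>s.
    (2 * n - 1) * (n + 1/2) * ((n + 1/2)^2 - 4 * A)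
        * (((s + (1 - n - b))^2 - D) * ((s + (1 - n - b) - 1)^2 - D))
    + (2 * n - 1) * n * (4 * A - 4 * b^2 + 2 * C + 2 * D - 1/2 - 2 * n^2)
        * (((s + (1/2 - n) - 1)^2 - A) * ((s + (1 - n - b))^2 - D))
    + 2 * ((n - 1/2)^4 - 2 * (n - 1/2)^2 * (C + D) + (C - D)^2)
        * (((s + (1/2 - n) - 1)^2 - A) * ((s + (1/2 - n))^2 - A))
   = ((s + (1/2 - n) - 1)^2 - A) * ((s + (1/2 - b))^2 - C) * (q0 + q1 * (s + 1) + q2 * (s + 1)^2)
    - (s^2 - A) * ((s + (1 - n - b))^2 - D) * (q0 + q1 * s + q2 * s^2)"
proof
  fix s
  let ?q0 = "1/8 - D - 1/2 * C - 1/2 * A - 2 * A * D + 2 * A * C - 1/2 * b + 2 * b * A + 3/2 * b^2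
      - 1/2 * n + 2 * n * D - 2 * n * C +
      4 * n * A + 2 * n * b - 4 * n * b * A - 1/2 * n^2 + 8 * n^2 * D - 2 * n^2 * C - 6 * n^2 * A
          + 2 * n^2 * b - 6 * n^2 * b^2 +
      2 * n^3 - 8 * n^3 * b"
  let ?q1 = "2 * C - 2 * A - b - 2 * b^2 + n - 8 * n * D + 4 * n * C + 4 * n * A - 4 * n * b
      + 4 * n * b^2 - 2 * n^2 + 12 * n^2 * b"
  let ?q2 = "2 * D - 2 * C + 2 * b - 4 * n * b"
  show "(2 * n - 1) * (n + 1/2) * ((n + 1/2)^2 - 4 * A)
      * (((s + (1 - n - b))^2 - D) * ((s + (1 - n - b) - 1)^2 - D))
    + (2 * n - 1) * n * (4 * A - 4 * b^2 + 2 * C + 2 * D - 1/2 - 2 * n^2)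
        * (((s + (1/2 - n) - 1)^2 - A) * ((s + (1 - n - b))^2 - D))
    + 2 * ((n - 1/2)^4 - 2 * (n - 1/2)^2 * (C + D) + (C - D)^2)
        * (((s + (1/2 - n) - 1)^2 - A) * ((s + (1/2 - n))^2 - A))
   = ((s + (1/2 - n) - 1)^2 - A) * ((s + (1/2 - b))^2 - C) * (?q0 + ?q1 * (s + 1) + ?q2 * (s + 1)^2)
    - (s^2 - A) * ((s + (1 - n - b))^2 - D) * (?q0 + ?q1 * s + ?q2 * s^2)"
    by algebra
qed

lemma certificate_34:
  fixes A C D b n :: complex
  obtains q0 q1 q2 where "\<And>s.
    2 * ((n + 1/2)^4 - 2 * (n + 1/2)^2 * (A + C) + (A - C)^2)
        * (((s + (1 - n - b))^2 - D) * ((s + (1 - n - b) - 1)^2 - D))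
    + (2 * n + 1) * n * (2 * A + 2 * C - 4 * b^2 + 4 * D - 1/2 - 2 * n^2)
        * (((s + (1/2 - n) - 1)^2 - C) * ((s + (1 - n - b))^2 - D))
    + (2 * n + 1) * (n - 1/2) * ((n - 1/2)^2 - 4 * D)
        * (((s + (1/2 - n) - 1)^2 - C) * ((s + (1/2 - n))^2 - C))
   = ((s + (1/2 - n) - 1)^2 - C) * ((s + (1/2 - b))^2 - D) * (q0 + q1 * (s + 1) + q2 * (s + 1)^2)
    - (s^2 - A) * ((s + (1 - n - b))^2 - D) * (q0 + q1 * s + q2 * s^2)"
proof
  fix s
  let ?q0 = "-1/8 + 3/2 * D + 1/2 * C + 2 * C * D - 2 * A * D + 1/2 * b - 2 * b * C - 3/2 * b^2
      - 2 * b^2 * C + 2 * b^2 * A + 6 * n * D -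
      2 * n * C - 8 * n * b * C + 4 * n * b * A - 6 * n * b^2 + 3/2 * n^2 + 6 * n^2 * D
          - 8 * n^2 * C + 2 * n^2 * A - 6 * n^2 * b -
      6 * n^2 * b^2 + 2 * n^3 - 8 * n^3 * b"
  let ?q1 = "-2 * D + 2 * C + b + 4 * b * C - 4 * b * A + 2 * b^2 - n - 4 * n * D + 8 * n * C
      - 4 * n * A + 8 * n * b + 4 * n * b^2 - 2 * n^2 +
      12 * n^2 * b"
  let ?q2 = "-2 * C + 2 * A - 2 * b - 4 * n * b"
  show "2 * ((n + 1/2)^4 - 2 * (n + 1/2)^2 * (A + C) + (A - C)^2)
      * (((s + (1 - n - b))^2 - D) * ((s + (1 - n - b) - 1)^2 - D))
    + (2 * n + 1) * n * (2 * A + 2 * C - 4 * b^2 + 4 * D - 1/2 - 2 * n^2)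
        * (((s + (1/2 - n) - 1)^2 - C) * ((s + (1 - n - b))^2 - D))
    + (2 * n + 1) * (n - 1/2) * ((n - 1/2)^2 - 4 * D)
        * (((s + (1/2 - n) - 1)^2 - C) * ((s + (1/2 - n))^2 - C))
   = ((s + (1/2 - n) - 1)^2 - C) * ((s + (1/2 - b))^2 - D) * (?q0 + ?q1 * (s + 1) + ?q2 * (s + 1)^2)
    - (s^2 - A) * ((s + (1 - n - b))^2 - D) * (?q0 + ?q1 * s + ?q2 * s^2)"
    by algebra
qed

section \<open>Contiguity relations for the differences of the eight series\<close>

text \<open>After centring s = z + a, the linear factors multiply in pairs to a square minus a
  constant, the form in which the certificates are stated. \<open>y_recurrence\<close> is applied at
  parameters already shifted by n, and its constant \<open>q2\<close> cancels between i and
  j.\<close>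

lemma D1_recurrence:
  fixes \<alpha> \<beta> :: "nat \<Rightarrow> complex" and n :: nat
  defines "N \<equiv> of_nat n"
  assumes n: "n \<ge> 1" and i: "i \<le> 7" "j \<le> 7"
    and bal: "\<beta> 1 + \<beta> 2 + \<beta> 3 = \<alpha> 0 + \<alpha> 1 + \<alpha> 2 + \<alpha> 3 + 1"
    and nonint: "\<And>i. i < 4 \<Longrightarrow> \<alpha> i \<notin> \<int>" "\<And>i j. i < 4 \<Longrightarrow> j \<in> {1..3} \<Longrightarrow> \<alpha> i - \<beta> j \<notin> \<int>"
    and pairs: "\<And>s. (\<beta> 1 - N + (s - a)) * (\<beta> 2 - N + (s - a)) = (s + u)^2 - B"
      "\<And>s. (\<alpha> 0 - N + (s - a)) * (\<alpha> 1 - N + (s - a)) = (s + v)^2 - E"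
      "\<And>s. (\<alpha> 2 + (s - a)) * (\<alpha> 3 + (s - a)) = (s + t)^2 - F"
      "\<And>s. (s - a) * (\<beta> 3 + (s - a) - 1) = s^2 - G"
    and certificate: "\<And>s. cp * (((s + u)^2 - B) * ((s + u - 1)^2 - B))
        + c0 * (((s + v - 1)^2 - E) * ((s + u)^2 - B))
        + cm * (((s + v - 1)^2 - E) * ((s + v)^2 - E))
      = ((s + v - 1)^2 - E) * ((s + t)^2 - F) * (q0 + q1 * (s + 1) + q2 * (s + 1)^2)
        - (s^2 - G) * ((s + u)^2 - B) * (q0 + q1 * s + q2 * s^2)"
  shows "cp * D1 i j (n + 1) \<alpha> \<beta> + c0 * D1 i j n \<alpha> \<beta> + cm * D1 i j (n - 1) \<alpha> \<beta> = 0"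
proof -
  define \<alpha>' where "\<alpha>' = \<alpha>(0 := \<alpha> 0 - N, 1 := \<alpha> 1 - N)"
  define \<beta>' where "\<beta>' = \<beta>(1 := \<beta> 1 - N, 2 := \<beta> 2 - N)"
  have shifts: "\<alpha>' k - \<alpha> k \<in> \<int>" "\<beta>' k - \<beta> k \<in> \<int>" for k
    by (auto simp: \<alpha>'_def \<beta>'_def N_def)
  have nonint': "\<alpha>' k \<notin> \<int>" if "k < 4" for k
    using nonint(1)[OF that] Ints_diff[of "\<alpha>' k" "\<alpha>' k - \<alpha> k"] shifts(1)[of k] by auto
  have nonint'': "\<alpha>' k - \<beta>' l \<notin> \<int>" if "k < 4" "l \<in> {1..3}" for k l
  proof
    assume "\<alpha>' k - \<beta>' l \<in> \<int>"
    from Ints_add[OF Ints_diff[OF this shifts(1)[of k]] shifts(2)[of l]] show False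
      using nonint(2)[OF that] by (simp add: algebra_simps)
  qed
  have bal': "\<beta>' 1 + \<beta>' 2 + \<beta>' 3 = \<alpha>' 0 + \<alpha>' 1 + \<alpha>' 2 + \<alpha>' 3 + 1"
    using bal by (simp add: \<alpha>'_def \<beta>'_def algebra_simps)
  \<comment> \<open>The quadratic is re-expanded from s to z = s - a. Its leading coefficient, hence
    the limit at infinity, remains \<open>q2\<close>.\<close>
  have certificate': "cp * ((\<beta>' 1 + z - 1) * (\<beta>' 1 + z) * (\<beta>' 2 + z - 1) * (\<beta>' 2 + z))
        + c0 * ((\<alpha>' 0 + z - 1) * (\<alpha>' 1 + z - 1) * (\<beta>' 1 + z) * (\<beta>' 2 + z))
        + cm * ((\<alpha>' 0 + z - 1) * (\<alpha>' 0 + z) * (\<alpha>' 1 + z - 1) * (\<alpha>' 1 + z))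
      = (\<alpha>' 0 + z - 1) * (\<alpha>' 1 + z - 1) * (\<alpha>' 2 + z) * (\<alpha>' 3 + z)
          * ((q0 + q1 * a + q2 * a^2) + (q1 + 2 * q2 * a) * (z + 1) + q2 * (z + 1)^2)
        - z * (\<beta>' 1 + z) * (\<beta>' 2 + z) * (\<beta>' 3 + z - 1)
          * ((q0 + q1 * a + q2 * a^2) + (q1 + 2 * q2 * a) * z + q2 * z^2)" for z
  proof -
    define s where "s = z + a"
    have z: "z = s - a"
      by (simp add: s_def)
    have vals: "\<beta>' 1 = \<beta> 1 - N" "\<beta>' 2 = \<beta> 2 - N" "\<beta>' 3 = \<beta> 3"
      "\<alpha>' 0 = \<alpha> 0 - N" "\<alpha>' 1 = \<alpha> 1 - N" "\<alpha>' 2 = \<alpha> 2" "\<alpha>' 3 = \<alpha> 3"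
      by (simp_all add: \<alpha>'_def \<beta>'_def)
    have factors: "(\<beta>' 1 + z - 1) * (\<beta>' 2 + z - 1) = (s + u - 1)^2 - B" "(\<beta>' 1 + z) * (\<beta>' 2 + z)
        = (s + u)^2 - B"
      "(\<alpha>' 0 + z - 1) * (\<alpha>' 1 + z - 1) = (s + v - 1)^2 - E" "(\<alpha>' 0 + z) * (\<alpha>' 1 + z)
          = (s + v)^2 - E"
      "(\<alpha>' 2 + z) * (\<alpha>' 3 + z) = (s + t)^2 - F" "z * (\<beta>' 3 + z - 1) = s^2 - G"
      using pairs(1)[of s] pairs(1)[of "s - 1"] pairs(2)[of s] pairs(2)[of "s - 1"] pairs(3,4)[of s]
      unfolding vals z by (simp_all add: algebra_simps)
    have q: "(q0 + q1 * a + q2 * a^2) + (q1 + 2 * q2 * a) * (z + 1) + q2 * (z + 1)^2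
        = q0 + q1 * (s + 1) + q2 * (s + 1)^2"
      "(q0 + q1 * a + q2 * a^2) + (q1 + 2 * q2 * a) * z + q2 * z^2 = q0 + q1 * s + q2 * s^2"
      unfolding z by algebra+
    show ?thesis
      using certificate[of s] unfolding q factors[symmetric] by (simp only: mult_ac)
  qed
  have shift: "y_shift k (n + 1) \<alpha> \<beta> = y k (\<alpha>'(0 := \<alpha>' 0 - 1, 1 := \<alpha>' 1 - 1))
      (\<beta>'(1 := \<beta>' 1 - 1, 2 := \<beta>' 2 - 1))"
    "y_shift k n \<alpha> \<beta> = y k \<alpha>' \<beta>'"
    "y_shift k (n - 1) \<alpha> \<beta> = y k (\<alpha>'(0 := \<alpha>' 0 + 1, 1 := \<alpha>' 1 + 1))
        (\<beta>'(1 := \<beta>' 1 + 1, 2 := \<beta>' 2 + 1))" for k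
    using n unfolding y_shift_def \<alpha>'_def \<beta>'_def N_def
    by (auto intro!: arg_cong2[of _ _ _ _ "y k"] simp: fun_eq_iff of_nat_diff algebra_simps)
  have "cp * y_shift k (n + 1) \<alpha> \<beta> + c0 * y_shift k n \<alpha> \<beta> + cm * y_shift k (n - 1) \<alpha> \<beta> = q2"
    if "k \<le> 7" for k
    unfolding shift by (rule y_recurrence[OF bal' nonint' nonint'' certificate' that])
  note eqs = this[OF i(1)] this[OF i(2)]
  have "cp * D1 i j (n + 1) \<alpha> \<beta> + c0 * D1 i j n \<alpha> \<beta> + cm * D1 i j (n - 1) \<alpha> \<beta>
      = (cp * y_shift i (n + 1) \<alpha> \<beta> + c0 * y_shift i n \<alpha> \<beta> + cm * y_shift i (n - 1) \<alpha> \<beta>)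
        - (cp * y_shift j (n + 1) \<alpha> \<beta> + c0 * y_shift j n \<alpha> \<beta> + cm * y_shift j (n - 1) \<alpha> \<beta>)"
    unfolding D1_def by algebra
  thus ?thesis
    unfolding eqs by simp
qed

text \<open>Common form of k = 1, with (x, w, z, v) = (A0, A1, A2, A3), and k = 2, with (A2, A1, A0,
  A3).\<close>

lemma D1_recurrence_12:
  fixes x z w v :: complex and n :: nat
  defines "N \<equiv> of_nat n"
  assumes n: "n \<ge> 1" and i: "i \<le> 7" "j \<le> 7"
    and nonint: "\<And>i. i < 4 \<Longrightarrow> \<alpha> i \<notin> \<int>" "\<And>i j. i < 4 \<Longrightarrow> j \<in> {1..3} \<Longrightarrow> \<alpha> i - \<beta> j \<notin> \<int>"
    and \<alpha>: "\<alpha> 0 = 1/2" "\<alpha> 1 = x + 1/2" "\<alpha> 2 = 1/2 * (x - w - z - v + 1)"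
        "\<alpha> 3 = 1/2 * (x - w + z + v + 1)"
    and \<beta>: "\<beta> 1 = 1/2 * (x - w - z + v + 1) + 1/2" "\<beta> 2 = 1/2 * (x - w + z - v + 1) + 1/2"
        "\<beta> 3 = x + 1"
  shows "(2 * N - 1) * (N + 1/2) * ((N + 1/2)^2 - x^2) * D1 i j (n + 1) \<alpha> \<beta>
    + (2 * N - 1) * N * (x^2 - w^2 + z^2 + v^2 - 1/2 - 2 * N^2) * D1 i j n \<alpha> \<beta>
    + 2 * (((N - 1/2)^2 - z^2) * ((N - 1/2)^2 - v^2)) * D1 i j (n - 1) \<alpha> \<beta> = 0"
proof -
  \<comment> \<open>With half sum and half difference of z and v one has 2 C + 2 D = z^2 + v^2 and C
    - D = z v, so the quartic coefficient of the certificate splits into two quadratic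
    factors.\<close>
  let ?A = "(1/2 * x)^2" and ?b = "1/2 * w" and ?C = "(1/2 * (z + v))^2" and ?D =
      "(1/2 * (z - v))^2"
  have coeffs: "(2 * N - 1) * (N + 1/2) * ((N + 1/2)^2 - 4 * ?A)
      = (2 * N - 1) * (N + 1/2) * ((N + 1/2)^2 - x^2)"
    "(2 * N - 1) * N * (4 * ?A - 4 * ?b^2 + 2 * ?C + 2 * ?D - 1/2 - 2 * N^2)
      = (2 * N - 1) * N * (x^2 - w^2 + z^2 + v^2 - 1/2 - 2 * N^2)"
    "2 * ((N - 1/2)^4 - 2 * (N - 1/2)^2 * (?C + ?D) + (?C - ?D)^2)
      = 2 * (((N - 1/2)^2 - z^2) * ((N - 1/2)^2 - v^2))"
    by algebra+
  obtain q0 q1 q2 where certificate: "\<And>s.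
      (2 * N - 1) * (N + 1/2) * ((N + 1/2)^2 - x^2)
          * (((s + (1 - N - ?b))^2 - ?D) * ((s + (1 - N - ?b) - 1)^2 - ?D))
      + (2 * N - 1) * N * (x^2 - w^2 + z^2 + v^2 - 1/2 - 2 * N^2)
          * (((s + (1/2 - N) - 1)^2 - ?A) * ((s + (1 - N - ?b))^2 - ?D))
      + 2 * (((N - 1/2)^2 - z^2) * ((N - 1/2)^2 - v^2))
          * (((s + (1/2 - N) - 1)^2 - ?A) * ((s + (1/2 - N))^2 - ?A))
     = ((s + (1/2 - N) - 1)^2 - ?A) * ((s + (1/2 - ?b))^2 - ?C)
         * (q0 + q1 * (s + 1) + q2 * (s + 1)^2)
      - (s^2 - ?A) * ((s + (1 - N - ?b))^2 - ?D) * (q0 + q1 * s + q2 * s^2)"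
    using certificate_12[where n = N and A = ?A and b = ?b and C = ?C and D = ?D] unfolding coeffs
        by blast
  show ?thesis
    unfolding N_def
  proof (rule D1_recurrence[OF n i _ nonint _ _ _ _ certificate[unfolded N_def], where a =
      "1/2 * x"])
    show "\<beta> 1 + \<beta> 2 + \<beta> 3 = \<alpha> 0 + \<alpha> 1 + \<alpha> 2 + \<alpha> 3 + 1"
      unfolding \<alpha> \<beta> by algebra
  qed (unfold \<alpha> \<beta>, (assumption | algebra)+)
qed

text \<open>Common form of k = 3, with (x, w, z, v) = (A0, A1, A2, A3), and k = 4, with (A2, A1, A3,
  A0). Now x and z enter through half sum and half difference, and v alone.\<close>

lemma D1_recurrence_34:
  fixes x z w v :: complex and n :: nat
  defines "N \<equiv> of_nat n"
  assumes n: "n \<ge> 1" and i: "i \<le> 7" "j \<le> 7"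
    and nonint: "\<And>i. i < 4 \<Longrightarrow> \<alpha> i \<notin> \<int>" "\<And>i j. i < 4 \<Longrightarrow> j \<in> {1..3} \<Longrightarrow> \<alpha> i - \<beta> j \<notin> \<int>"
    and \<alpha>: "\<alpha> 0 = x + 1/2" "\<alpha> 1 = z + 1/2" "\<alpha> 2 = 1/2 * (x - w + z + v + 1)"
        "\<alpha> 3 = 1/2 * (x - w + z - v + 1)"
    and \<beta>: "\<beta> 1 = 1/2 * (x - w + z + v + 1) + 1/2" "\<beta> 2 = 1/2 * (x - w + z - v + 1) + 1/2"
        "\<beta> 3 = x + z + 1"
  shows "2 * (((N + 1/2)^2 - x^2) * ((N + 1/2)^2 - z^2)) * D1 i j (n + 1) \<alpha> \<beta>
    + (2 * N + 1) * N * (x^2 - w^2 + z^2 + v^2 - 1/2 - 2 * N^2) * D1 i j n \<alpha> \<beta>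
    + (2 * N + 1) * (N - 1/2) * ((N - 1/2)^2 - v^2) * D1 i j (n - 1) \<alpha> \<beta> = 0"
proof -
  let ?A = "(1/2 * (x + z))^2" and ?b = "1/2 * w" and ?C = "(1/2 * (x - z))^2" and ?D =
      "(1/2 * v)^2"
  have coeffs: "2 * ((N + 1/2)^4 - 2 * (N + 1/2)^2 * (?A + ?C) + (?A - ?C)^2)
      = 2 * (((N + 1/2)^2 - x^2) * ((N + 1/2)^2 - z^2))"
    "(2 * N + 1) * N * (2 * ?A + 2 * ?C - 4 * ?b^2 + 4 * ?D - 1/2 - 2 * N^2)
      = (2 * N + 1) * N * (x^2 - w^2 + z^2 + v^2 - 1/2 - 2 * N^2)"
    "(2 * N + 1) * (N - 1/2) * ((N - 1/2)^2 - 4 * ?D)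
        = (2 * N + 1) * (N - 1/2) * ((N - 1/2)^2 - v^2)"
    by algebra+
  obtain q0 q1 q2 where certificate: "\<And>s.
      2 * (((N + 1/2)^2 - x^2) * ((N + 1/2)^2 - z^2))
          * (((s + (1 - N - ?b))^2 - ?D) * ((s + (1 - N - ?b) - 1)^2 - ?D))
      + (2 * N + 1) * N * (x^2 - w^2 + z^2 + v^2 - 1/2 - 2 * N^2)
          * (((s + (1/2 - N) - 1)^2 - ?C) * ((s + (1 - N - ?b))^2 - ?D))
      + (2 * N + 1) * (N - 1/2) * ((N - 1/2)^2 - v^2)
          * (((s + (1/2 - N) - 1)^2 - ?C) * ((s + (1/2 - N))^2 - ?C))
     = ((s + (1/2 - N) - 1)^2 - ?C) * ((s + (1/2 - ?b))^2 - ?D)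
         * (q0 + q1 * (s + 1) + q2 * (s + 1)^2)
      - (s^2 - ?A) * ((s + (1 - N - ?b))^2 - ?D) * (q0 + q1 * s + q2 * s^2)"
    using certificate_34[where n = N and A = ?A and b = ?b and C = ?C and D = ?D] unfolding coeffs
        by blast
  show ?thesis
    unfolding N_def
  proof (rule D1_recurrence[OF n i _ nonint _ _ _ _ certificate[unfolded N_def], where a =
      "1/2 * (x + z)"])
    show "\<beta> 1 + \<beta> 2 + \<beta> 3 = \<alpha> 0 + \<alpha> 1 + \<alpha> 2 + \<alpha> 3 + 1"
      unfolding \<alpha> \<beta> by algebra
  qed (unfold \<alpha> \<beta>, (assumption | algebra)+)
qed

section \<open>Frobenius series\<close>

text \<open>With F the power series, the value \<rho> F + x F' is x^(-\<rho>) times the Euler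
  operator x d/dx applied to x^\<rho> F.\<close>

lemma frobenius_theta_sums:
  fixes C :: "nat \<Rightarrow> complex"
  assumes "ereal (norm x) < conv_radius C"
  shows "(\<lambda>n. (\<rho> + of_nat n) * C n * x ^ n) sums
    (\<rho> * (\<Sum>n. C n * x ^ n) + x * (\<Sum>n. diffs C n * x ^ n))"
proof -
  obtain r where r: "norm x < r" "ereal r < conv_radius C"
    using ereal_dense2[OF assms] by auto
  have "summable (\<lambda>n. diffs C n * x ^ n)"
  proof (rule termdiff_converges[OF r(1)])
    fix z :: complex
    assume "norm z < r"
    hence "ereal (norm z) < ereal r"
      by simp
    thus "summable (\<lambda>n. C n * z ^ n)"
      using r(2) by (intro summable_in_conv_radius) (rule less_trans)
  qed
  from sums_add[OF sums_mult[OF summable_sums[OF summable_in_conv_radius[OF assms]]]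
      sums_mult[OF diffs_equiv[OF this]], of \<rho> x]
  show ?thesis
  proof (rule sums_cong[THEN iffD1, rotated])
    show "\<rho> * (C n * x ^ n) + x * (of_nat n * C n * x ^ (n - Suc 0)) = (\<rho> + of_nat n) * C n * x ^ n"
        for n
      by (cases n) (simp_all add: algebra_simps)
  qed
qed

lemma frobenius_series_has_derivative:
  assumes "x \<notin> \<real>\<^sub>\<le>\<^sub>0" "ereal (norm x) < conv_radius C"
  shows "(frobenius_series \<rho> C has_field_derivative frobenius_series (\<rho> - 1) (\<lambda>n. (\<rho> + of_nat n)
      * C n) x) (at x)"
proof -
  have x: "x \<noteq> 0"
    using assms(1) by auto
  have "((\<lambda>x. x powr \<rho> * (\<Sum>n. C n * x ^ n)) has_field_derivative
      (x powr \<rho> * (\<Sum>n. diffs C n * x ^ n) + \<rho> * x powr (\<rho> - 1) * (\<Sum>n. C n * x ^ n))) (at x)"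
    by (intro DERIV_mult' has_field_derivative_powr has_field_derivative_powser assms)
  also have "x powr \<rho> * (\<Sum>n. diffs C n * x ^ n) + \<rho> * x powr (\<rho> - 1) * (\<Sum>n. C n * x ^ n)
      = x powr (\<rho> - 1) * (\<rho> * (\<Sum>n. C n * x ^ n) + x * (\<Sum>n. diffs C n * x ^ n))"
    using x by (simp add: powr_diff field_simps)
  also have "\<dots> = frobenius_series (\<rho> - 1) (\<lambda>n. (\<rho> + of_nat n) * C n) x"
    using frobenius_theta_sums[OF assms(2), of \<rho>] by (simp add: frobenius_series_def sums_iff)
  finally show ?thesis
    by (simp add: frobenius_series_def[abs_def])
qed

lemma conv_radius_theta:
  fixes C :: "nat \<Rightarrow> complex"
  shows "conv_radius C \<le> conv_radius (\<lambda>n. (\<rho> + of_nat n) * C n)"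
  by (rule conv_radius_geI_ex') (use frobenius_theta_sums[of "of_real r" C \<rho>
      for r] in \<open>auto simp: sums_iff\<close>)

text \<open>Differentiation lowers the exponent \<rho> and leaves the index n alone, so all
  derivatives stay aligned term by term and no initial coefficient is lost.\<close>

fun deriv_coeff :: "complex \<Rightarrow> (nat \<Rightarrow> complex) \<Rightarrow> nat \<Rightarrow> nat \<Rightarrow> complex" where
  "deriv_coeff \<rho> C 0 = C"
| "deriv_coeff \<rho> C (Suc k) = (\<lambda>n. (\<rho> - of_nat k + of_nat n) * deriv_coeff \<rho> C k n)"

lemma conv_radius_deriv_coeff: "conv_radius C \<le> conv_radius (deriv_coeff \<rho> C k)"
  by (induction k) (auto intro: order_trans conv_radius_theta)

lemma frobenius_series_iterated_deriv:
  assumes "x \<notin> \<real>\<^sub>\<le>\<^sub>0" "ereal (norm x) < conv_radius C"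
  shows "(deriv ^^ k) (frobenius_series \<rho> C) x
      = frobenius_series (\<rho> - of_nat k) (deriv_coeff \<rho> C k) x"
  using assms
proof (induction k arbitrary: x)
  case 0
  show ?case by simp
next
  case (Suc k)
  let ?S = "eball (0 :: complex) (conv_radius C) - \<real>\<^sub>\<le>\<^sub>0"
  have x: "x \<in> ?S"
    using Suc.prems by (simp add: in_eball_iff)
  have "(frobenius_series (\<rho> - of_nat k) (deriv_coeff \<rho> C k) has_field_derivative
      frobenius_series (\<rho> - of_nat (Suc k)) (deriv_coeff \<rho> C (Suc k)) x) (at x)"
    using frobenius_series_has_derivative[of x "deriv_coeff \<rho> C k" "\<rho> - of_nat k"]
      Suc.prems less_le_trans[OF _ conv_radius_deriv_coeff]
    by (simp add: algebra_simps)
  moreover have "open ?S"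
    by (intro open_Diff open_eball closed_nonpos_Reals_complex)
  ultimately have "((deriv ^^ k) (frobenius_series \<rho> C) has_field_derivative
      frobenius_series (\<rho> - of_nat (Suc k)) (deriv_coeff \<rho> C (Suc k)) x) (at x)"
    by (rule has_field_derivative_transform_within_open) (use x Suc.IH in \<open>auto simp: in_eball_iff\<close>)
  thus ?case
    by (simp add: DERIV_imp_deriv)
qed

lemma frobenius_recurrence_solution:
  fixes A0 A1 A2 A3 :: complex
  assumes rec: "\<And>n. n \<ge> 1 \<Longrightarrow>
      (of_nat n + 1) * of_nat n * ((of_nat n + 1/2)^2 - A0^2) * C (n + 1)
      + of_nat n ^ 2 * (A0^2 - A1^2 + A2^2 + A3^2 - 1/2 - 2 * of_nat n ^ 2) * C n
      + ((of_nat n - 1/2)^2 - A2^2) * ((of_nat n - 1/2)^2 - A3^2) * C (n - 1) = 0"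
    and x: "x \<notin> \<real>\<^sub>\<le>\<^sub>0" "ereal (norm x) < conv_radius C"
  shows "Z (A0, A1, A2, A3) (frobenius_series (A0 - 1/2) C) x = 0"
proof -
  define \<rho> where "\<rho> = A0 - 1/2"
  define S where "S k = (\<Sum>n. deriv_coeff \<rho> C k n * x ^ n)" for k
  have sums: "(\<lambda>n. deriv_coeff \<rho> C k n * x ^ n) sums S k" for k
    unfolding S_def
    by (intro summable_sums summable_in_conv_radius less_le_trans[OF x(2) conv_radius_deriv_coeff])
  have coeffs: "deriv_coeff \<rho> C 1 n = (\<rho> + of_nat n) * C n"
    "deriv_coeff \<rho> C 2 n = (\<rho> + of_nat n - 1) * ((\<rho> + of_nat n) * C n)"
    "deriv_coeff \<rho> C 3 n = (\<rho> + of_nat n - 2) * ((\<rho> + of_nat n - 1) * ((\<rho> + of_nat n) * C n))"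
    "deriv_coeff \<rho> C 4 n = (\<rho> + of_nat n - 3)
        * ((\<rho> + of_nat n - 2) * ((\<rho> + of_nat n - 1) * ((\<rho> + of_nat n) * C n)))" for n
    by (simp_all add: numeral_eq_Suc algebra_simps)
  \<comment> \<open>The terms x^j d^k of Z(A) are grouped by their weight j - k: \<open>TA\<close>
    has weight -1, \<open>TB\<close> weight 0 and \<open>TC\<close> weight 1.\<close>
  define TA where "TA = S 4 + 2 * (3 - 2 * A0) * S 3 + 1/4 * (10 * A0 - 9) * (2 * A0 - 3) * S 2
    + - 1/4 * (2 * A0 - 3) * (2 * A0 - 1)^2 * S 1"
  define TB where "TB = - 2 * S 4 + (8 * A0 - 16) * S 3
    + (- 11 * A0^2 - A1^2 + A2^2 + A3^2 + 36 * A0 - 59/2) * S 2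
    + (A0 - 1) * (6 * A0^2 + 2 * A1^2 - 2 * A2^2 - 2 * A3^2 - 16 * A0 + 11) * S 1
    + - 1/4 * (2 * A0 - 1)^2 * (A0^2 + A1^2 - A2^2 - A3^2 - 2 * A0 + 1) * S 0"
  define TC where "TC = S 4 + (10 - 4 * A0) * S 3 + (6 * A0^2 - A2^2 - A3^2 - 24 * A0 + 25) * S 2
    + - (2 * A0 - 3) * (2 * A0^2 - A2^2 - A3^2 - 6 * A0 + 5) * S 1
    + (A0 - 1 + A3) * (A0 - 1 - A3) * (A0 - 1 + A2) * (A0 - 1 - A2) * S 0"
  \<comment> \<open>The factor of C n is the indicial polynomial at A0 - 1/2 + n. Its roots n = 0,
    1, 1/2 - A0, 1/2 + A0 are the four local exponents.\<close>
  define a where "a n = of_nat n * (of_nat n - 1) * ((of_nat n - 1/2)^2 - A0^2) * C n" for n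
  define b where "b n = of_nat n ^ 2 * (A0^2 - A1^2 + A2^2 + A3^2 - 1/2 - 2 * of_nat n ^ 2) * C n"
      for n
  define c where "c n = ((of_nat n + 1/2)^2 - A2^2) * ((of_nat n + 1/2)^2 - A3^2) * C n" for n
  have TA: "(\<lambda>n. a n * x ^ n) sums TA"
  proof -
    have "(\<lambda>n. deriv_coeff \<rho> C 4 n * x ^ n + 2 * (3 - 2 * A0) * (deriv_coeff \<rho> C 3 n * x ^ n)
        + 1/4 * (10 * A0 - 9) * (2 * A0 - 3) * (deriv_coeff \<rho> C 2 n * x ^ n)
        + - 1/4 * (2 * A0 - 3) * (2 * A0 - 1)^2 * (deriv_coeff \<rho> C 1 n * x ^ n)) sums TA"
      unfolding TA_def by (intro sums_add sums_mult sums)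
    also have "(\<lambda>n. deriv_coeff \<rho> C 4 n * x ^ n + 2 * (3 - 2 * A0) * (deriv_coeff \<rho> C 3 n * x ^ n)
        + 1/4 * (10 * A0 - 9) * (2 * A0 - 3) * (deriv_coeff \<rho> C 2 n * x ^ n)
        + - 1/4 * (2 * A0 - 3) * (2 * A0 - 1)^2 * (deriv_coeff \<rho> C 1 n * x ^ n))
            = (\<lambda>n. a n * x ^ n)"
      unfolding coeffs unfolding a_def \<rho>_def by (rule ext) algebra
    finally show ?thesis .
  qed
  have TB: "(\<lambda>n. b n * x ^ n) sums TB"
  proof -
    have "(\<lambda>n. - 2 * (deriv_coeff \<rho> C 4 n * x ^ n) + (8 * A0 - 16) * (deriv_coeff \<rho> C 3 n * x ^ n)
        + (- 11 * A0^2 - A1^2 + A2^2 + A3^2 + 36 * A0 - 59/2) * (deriv_coeff \<rho> C 2 n * x ^ n)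
        + (A0 - 1) * (6 * A0^2 + 2 * A1^2 - 2 * A2^2 - 2 * A3^2 - 16 * A0 + 11)
            * (deriv_coeff \<rho> C 1 n * x ^ n)
        + - 1/4 * (2 * A0 - 1)^2 * (A0^2 + A1^2 - A2^2 - A3^2 - 2 * A0 + 1)
            * (deriv_coeff \<rho> C 0 n * x ^ n)) sums TB"
      unfolding TB_def by (intro sums_add sums_mult sums)
    also have "(\<lambda>n. - 2 * (deriv_coeff \<rho> C 4 n * x ^ n)
        + (8 * A0 - 16) * (deriv_coeff \<rho> C 3 n * x ^ n)
        + (- 11 * A0^2 - A1^2 + A2^2 + A3^2 + 36 * A0 - 59/2) * (deriv_coeff \<rho> C 2 n * x ^ n)
        + (A0 - 1) * (6 * A0^2 + 2 * A1^2 - 2 * A2^2 - 2 * A3^2 - 16 * A0 + 11)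
            * (deriv_coeff \<rho> C 1 n * x ^ n)
        + - 1/4 * (2 * A0 - 1)^2 * (A0^2 + A1^2 - A2^2 - A3^2 - 2 * A0 + 1)
            * (deriv_coeff \<rho> C 0 n * x ^ n)) = (\<lambda>n. b n * x ^ n)"
      unfolding coeffs deriv_coeff.simps(1) unfolding b_def \<rho>_def by (rule ext) algebra
    finally show ?thesis .
  qed
  have TC: "(\<lambda>n. c n * x ^ n) sums TC"
  proof -
    have "(\<lambda>n. deriv_coeff \<rho> C 4 n * x ^ n + (10 - 4 * A0) * (deriv_coeff \<rho> C 3 n * x ^ n)
        + (6 * A0^2 - A2^2 - A3^2 - 24 * A0 + 25) * (deriv_coeff \<rho> C 2 n * x ^ n)
        + - (2 * A0 - 3) * (2 * A0^2 - A2^2 - A3^2 - 6 * A0 + 5) * (deriv_coeff \<rho> C 1 n * x ^ n)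
        + (A0 - 1 + A3) * (A0 - 1 - A3) * (A0 - 1 + A2) * (A0 - 1 - A2)
            * (deriv_coeff \<rho> C 0 n * x ^ n)) sums TC"
      unfolding TC_def by (intro sums_add sums_mult sums)
    also have "(\<lambda>n. deriv_coeff \<rho> C 4 n * x ^ n + (10 - 4 * A0) * (deriv_coeff \<rho> C 3 n * x ^ n)
        + (6 * A0^2 - A2^2 - A3^2 - 24 * A0 + 25) * (deriv_coeff \<rho> C 2 n * x ^ n)
        + - (2 * A0 - 3) * (2 * A0^2 - A2^2 - A3^2 - 6 * A0 + 5) * (deriv_coeff \<rho> C 1 n * x ^ n)
        + (A0 - 1 + A3) * (A0 - 1 - A3) * (A0 - 1 + A2) * (A0 - 1 - A2)
            * (deriv_coeff \<rho> C 0 n * x ^ n)) = (\<lambda>n. c n * x ^ n)"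
      unfolding coeffs deriv_coeff.simps(1) unfolding c_def \<rho>_def by (rule ext) algebra
    finally show ?thesis .
  qed
  \<comment> \<open>Because a 0 = a 1 = 0 and b 0 = 0, re-indexing leaves no initial terms; this is
    why C 0 and C 1 are free.\<close>
  have "(\<lambda>n. a (n + 2) * x ^ (n + 2)) sums TA"
    using TA sums_iff_shift[of "\<lambda>n. a n * x ^ n" 2 TA] by (simp add: a_def numeral_2_eq_2)
  moreover have "(\<lambda>n. b (n + 1) * x ^ (n + 1)) sums TB"
    using TB sums_iff_shift[of "\<lambda>n. b n * x ^ n" 1 TB] by (simp add: b_def)
  ultimately have "(\<lambda>n. a (n + 2) * x ^ (n + 2) + x * (b (n + 1) * x ^ (n + 1))
      + x^2 * (c n * x ^ n)) sums (TA + x * TB + x^2 * TC)"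
    by (intro sums_add sums_mult TC)
  moreover have "a (n + 2) * x ^ (n + 2) + x * (b (n + 1) * x ^ (n + 1)) + x^2 * (c n * x ^ n) = 0"
      for n
  proof -
    have "of_nat (n + 2) = (of_nat n + 2 :: complex)" "of_nat (n + 1) = (of_nat n + 1 :: complex)"
      by simp_all
    hence "a (n + 2) + b (n + 1) + c n = 0"
      using rec[of "n + 1"] unfolding a_def b_def c_def by (simp add: algebra_simps)
    moreover have "a (n + 2) * x ^ (n + 2) + x * (b (n + 1) * x ^ (n + 1)) + x^2 * (c n * x ^ n)
        = (a (n + 2) + b (n + 1) + c n) * x ^ (n + 2)"
      by (simp add: algebra_simps power2_eq_square)
    ultimately show ?thesis
      by simp
  qed
  ultimately have zero: "TA + x * TB + x^2 * TC = 0"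
    by (simp add: sums_iff)
  have nz: "x \<noteq> 0"
    using x(1) by auto
  have deriv: "(deriv ^^ k) (frobenius_series (A0 - 1/2) C) x = x powr \<rho> / x ^ k * S k" for k
    using frobenius_series_iterated_deriv[OF x, of k \<rho>] nz
    by (simp add: frobenius_series_def S_def powr_diff powr_nat \<rho>_def)
  define P where "P = x powr \<rho> / x ^ 4"
  have P: "x powr \<rho> / x ^ 0 = P * x^4" "x powr \<rho> / x ^ 1 = P * x^3" "x powr \<rho> / x ^ 2 = P * x^2"
    "x powr \<rho> / x ^ 3 = P * x" "x powr \<rho> / x ^ 4 = P"
    using nz by (simp_all add: P_def field_simps eval_nat_numeral)
  have "Z (A0, A1, A2, A3) (frobenius_series (A0 - 1/2) C) x =
      p0 (A0, A1, A2, A3) x * (P * S 4) + p1 (A0, A1, A2, A3) x * (P * x * S 3)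
      + p2 (A0, A1, A2, A3) x * (P * x^2 * S 2) + p3 (A0, A1, A2, A3) x * (P * x^3 * S 1)
      + p4 (A0, A1, A2, A3) x * (P * x^4 * S 0)"
    using deriv[of 0] deriv[of 1] deriv[of 2] deriv[of 3] deriv[of 4] unfolding P
    by (simp add: Z_def)
  also have "\<dots> = P * x^3 * (TA + x * TB + x^2 * TC)"
    unfolding TA_def TB_def TC_def p0.simps p1.simps p2.simps p3.simps p4.simps by algebra
  finally show ?thesis
    by (simp add: zero)
qed

section \<open>Positive radius of convergence from the recurrence\<close>

text \<open>Induction gives |C n| <= K (2 M)^n, the factor 2 absorbing the sum of two terms since 2
  M >= 1. At x = 1/(4 M) the series is then dominated by a geometric one of ratio 1/2.\<close>

lemma geometric_growth_conv_radius:
  fixes C :: "nat \<Rightarrow> complex"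
  assumes growth: "\<And>n. norm (C (n + 2)) \<le> M * (norm (C (n + 1)) + norm (C n))" and M: "M \<ge> 1"
  shows "conv_radius C > 0"
proof -
  let ?K = "norm (C 0) + norm (C 1)"
  have "norm (C n) \<le> ?K * (2 * M) ^ n \<and> norm (C (n + 1)) \<le> ?K * (2 * M) ^ (n + 1)" for n
  proof (induction n)
    case 0
    have "?K * 1 \<le> ?K * (2 * M)"
      using M by (intro mult_left_mono) auto
    thus ?case
      using norm_ge_zero[of "C 0"] norm_ge_zero[of "C 1"]
      unfolding power_0 add_0 power_one_right mult_1_right by (intro conjI; linarith)
  next
    case (Suc n)
    have "norm (C (n + 2)) \<le> M * (?K * (2 * M) ^ (n + 1) + ?K * (2 * M) ^ n)"
      using Suc.IH M by (intro order_trans[OF growth] mult_left_mono add_mono) auto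
    also have "\<dots> \<le> M * (?K * (2 * M) ^ (n + 1) + ?K * (2 * M) ^ (n + 1))"
      using M by (intro mult_left_mono add_left_mono power_increasing) auto
    also have "\<dots> = ?K * (2 * M) ^ (n + 2)"
      by simp
    finally show ?case
      using Suc.IH by simp
  qed
  hence bound: "norm (C n) \<le> ?K * (2 * M) ^ n" for n
    by blast
  have "summable (\<lambda>n. C n * of_real (inverse (4 * M)) ^ n)"
  proof (rule summable_comparison_test')
    show "summable (\<lambda>n. ?K * (1/2) ^ n)"
      by (intro summable_mult summable_geometric) simp
    show "norm (C n * of_real (inverse (4 * M)) ^ n) \<le> ?K * (1/2) ^ n" for n
    proof -
      have "norm (C n * of_real (inverse (4 * M)) ^ n) = norm (C n) * inverse (4 * M) ^ n"
        using M by (simp add: norm_mult norm_power del: of_real_inverse of_real_mult)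
      also have "\<dots> \<le> ?K * (2 * M) ^ n * inverse (4 * M) ^ n"
        using M by (intro mult_right_mono bound) auto
      also have "\<dots> = ?K * (2 * M * inverse (4 * M)) ^ n"
        by (simp only: power_mult_distrib mult.assoc)
      also have "2 * M * inverse (4 * M) = 1/2"
        using M by simp
      finally show ?thesis .
    qed
  qed
  from conv_radius_geI[OF this] have "ereal (inverse (4 * M)) \<le> conv_radius C"
    using M by (simp del: of_real_inverse of_real_mult)
  moreover have "0 < ereal (inverse (4 * M))"
    using M by simp
  ultimately show ?thesis
    by (rule less_le_trans[rotated])
qed

text \<open>All three coefficients of the recurrence have degree at most 4 in n and the leading one
  has degree exactly 4 without zeros at n >= 1, so the quotients by it are bounded.\<close>

lemma recurrence_conv_radius:
  fixes A0 A1 A2 A3 :: complex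
  assumes rec: "\<And>n. n \<ge> 1 \<Longrightarrow>
      (of_nat n + 1) * of_nat n * ((of_nat n + 1/2)^2 - A0^2) * C (n + 1)
      + of_nat n ^ 2 * (A0^2 - A1^2 + A2^2 + A3^2 - 1/2 - 2 * of_nat n ^ 2) * C n
      + ((of_nat n - 1/2)^2 - A2^2) * ((of_nat n - 1/2)^2 - A3^2) * C (n - 1) = 0"
    and nonzero: "\<And>n. n \<ge> 1 \<Longrightarrow> (of_nat n + 1/2)^2 \<noteq> A0^2"
  shows "conv_radius C > 0"
proof -
  define N where "N n = (of_nat (Suc n) :: complex)" for n
  have N: "norm (N n) = real (Suc n)" "N n \<noteq> 0" for n
    unfolding N_def norm_of_nat by (simp_all del: of_nat_Suc)
  define K where "K = A0^2 - A1^2 + A2^2 + A3^2 - 1/2"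
  define R where "R n = N n ^ 2 / ((N n + 1/2)^2 - A0^2)" for n
  have nz: "(N n + 1/2)^2 - A0^2 \<noteq> 0" for n
    using nonzero[of "Suc n"] unfolding N_def by simp
  have "R \<longlonglongrightarrow> 1 / ((1 + 1/2 * 0)^2 - A0^2 * 0^2)"
  proof (rule Lim_transform_eventually)
    show "(\<lambda>n. 1 / ((1 + 1/2 * inverse (N n))^2 - A0^2 * inverse (N n)^2))
        \<longlonglongrightarrow> 1 / ((1 + 1/2 * 0)^2 - A0^2 * 0^2)"
      unfolding N_def by (intro tendsto_intros LIMSEQ_Suc[OF lim_inverse_n]) simp
    have "1 / ((1 + 1/2 * inverse (N n))^2 - A0^2 * inverse (N n)^2) = R n" for n
    proof -
      have "(1 + 1/2 * inverse (N n))^2 - A0^2 * inverse (N n)^2 = ((N n + 1/2)^2 - A0^2) / N n ^ 2"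
        using N(2)[of n] by (simp add: field_simps power2_eq_square)
      thus ?thesis
        by (simp add: R_def)
    qed
    thus "eventually (\<lambda>n. 1 / ((1 + 1/2 * inverse (N n))^2 - A0^2 * inverse (N n)^2)
        = R n) sequentially"
      by simp
  qed
  hence "Bseq R"
    by (intro convergent_imp_Bseq convergentI)
  then obtain B where B: "B > 0" "\<And>n. norm (R n) \<le> B"
    by (auto elim: BseqE)
  define k1 where "k1 = norm K + 2"
  define k2 where "k2 = (1 + norm A2 ^ 2) * (1 + norm A3 ^ 2)"
  define M where "M = 1 + B * k1 + B * k2"
  have k: "k1 \<ge> 0" "k2 \<ge> 0"
    by (simp_all add: k1_def k2_def)
  have M: "B * k1 \<le> M" "B * k2 \<le> M" "1 \<le> M"
    using k B(1) by (simp_all add: M_def)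
  have quad: "norm (z - w) \<le> (k + norm w) * norm (N n) ^ 2" if "norm z \<le> k * norm (N n) ^ 2"
      for z w k n
  proof -
    have "norm w * 1 \<le> norm w * norm (N n) ^ 2"
      unfolding N(1) by (intro mult_left_mono one_le_power) auto
    with norm_triangle_ineq4[of z w] that show ?thesis
      by (simp add: algebra_simps)
  qed
  show ?thesis
  proof (rule geometric_growth_conv_radius)
    show "M \<ge> 1"
      by (rule M)
    fix n
    have "norm (2 * N n ^ 2 - K) \<le> (2 + norm K) * norm (N n) ^ 2"
      by (rule quad) (simp add: norm_mult norm_power)
    hence bK: "norm (K - 2 * N n ^ 2) \<le> (norm K + 2) * norm (N n) ^ 2"
      by (simp add: norm_minus_commute add.commute)
    have half: "norm ((N n - 1/2)^2) \<le> 1 * norm (N n) ^ 2"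
    proof -
      have "N n - 1/2 = of_real (real n + 1/2)"
        by (simp add: N_def)
      hence "norm (N n - 1/2) = real n + 1/2"
        by (simp only: norm_of_real)
      thus ?thesis
        unfolding norm_power N(1) mult_1 by (intro power_mono) auto
    qed
    have b2: "norm ((N n - 1/2)^2 - A2^2) \<le> (1 + norm A2 ^ 2) * norm (N n) ^ 2"
      and b3: "norm ((N n - 1/2)^2 - A3^2) \<le> (1 + norm A3 ^ 2) * norm (N n) ^ 2"
      using quad[OF half, of "A2^2"] quad[OF half, of "A3^2"] by (simp_all add: norm_power)
    let ?D = "(N n + 1) * N n * ((N n + 1/2)^2 - A0^2)"
    let ?b = "N n ^ 2 * (K - 2 * N n ^ 2)"
    let ?c = "((N n - 1/2)^2 - A2^2) * ((N n - 1/2)^2 - A3^2)"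
    have N1: "N n + 1 = of_nat (n + 2)"
      by (simp add: N_def)
    have normN1: "norm (N n + 1) = real (n + 2)"
      unfolding N1 norm_of_nat ..
    have D: "?D \<noteq> 0"
      using N(2)[of n] nz[of n] normN1 by auto
    \<comment> \<open>Of the four powers of N, two are absorbed by the bounded sequence
      \<open>R\<close> and two by the factor (N + 1) N of \<open>?D\<close>.\<close>
    have bound: "norm (z / ?D) \<le> B * k" if z: "norm z \<le> k * norm (N n) ^ 4" "k \<ge> 0" for z k
    proof -
      have "norm z * norm (R n) \<le> (k * norm (N n) ^ 4) * B"
        using z B(1) by (intro mult_mono B(2)) auto
      hence "norm z / norm ((N n + 1/2)^2 - A0^2) * norm (N n) ^ 2
          \<le> B * k * norm (N n) ^ 2 * norm (N n) ^ 2"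
        unfolding R_def norm_divide norm_power by (simp add: mult_ac flip: power_add)
      hence "norm z / norm ((N n + 1/2)^2 - A0^2) \<le> B * k * norm (N n) ^ 2"
        by (rule mult_right_le_imp_le) (use N(2)[of n] in simp)
      also have "\<dots> \<le> B * k * (norm (N n + 1) * norm (N n))"
        unfolding normN1 N(1) power2_eq_square using B(1) z(2)
            by (intro mult_left_mono mult_right_mono) auto
      finally have "norm z / norm ((N n + 1/2)^2 - A0^2) / (norm (N n + 1) * norm (N n)) \<le> B * k"
        using N(2)[of n] normN1 by (subst pos_divide_le_eq) auto
      thus ?thesis
        by (simp only: norm_divide norm_mult divide_divide_eq_left mult_ac)
    qed
    have "norm ?b \<le> k1 * norm (N n) ^ 4"
      unfolding k1_def
      using mult_left_mono[OF bK, of "norm (N n) ^ 2"]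
      by (simp add: norm_mult norm_power eval_nat_numeral mult_ac)
    hence b: "norm (?b / ?D) \<le> M"
      using bound[of ?b k1] k(1) M(1) by linarith
    have "norm ?c \<le> (1 + norm A2 ^ 2) * norm (N n) ^ 2 * ((1 + norm A3 ^ 2) * norm (N n) ^ 2)"
      unfolding norm_mult by (intro mult_mono b2 b3) auto
    also have "\<dots> = k2 * norm (N n) ^ 4"
      by (simp add: k2_def mult_ac flip: power_add)
    finally have c: "norm (?c / ?D) \<le> M"
      using bound[of ?c k2] k(2) M(2) by linarith
    have "?D * C (n + 2) + ?b * C (n + 1) + ?c * C n = 0"
      using rec[of "Suc n"] unfolding K_def N_def by simp
    hence "?D * (C (n + 2) + (?b / ?D * C (n + 1) + ?c / ?D * C n)) = 0"
      using D by (simp only: distrib_left times_divide_eq_left times_divide_eq_right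
          nonzero_mult_div_cancel_left[OF D] add.assoc)
    hence "C (n + 2) = - (?b / ?D * C (n + 1) + ?c / ?D * C n)"
      using D unfolding eq_neg_iff_add_eq_0 by (metis mult_eq_0_iff)
    hence "norm (C (n + 2)) \<le> norm (?b / ?D) * norm (C (n + 1)) + norm (?c / ?D) * norm (C n)"
      using norm_triangle_ineq[of "?b / ?D * C (n + 1)" "?c / ?D * C n"]
          by (simp only: norm_minus_cancel norm_mult)
    also have "\<dots> \<le> M * norm (C (n + 1)) + M * norm (C n)"
      by (intro add_mono mult_right_mono b c) auto
    finally show "norm (C (n + 2)) \<le> M * (norm (C (n + 1)) + norm (C n))"
      by (simp add: distrib_left)
  qed
qed

section \<open>Generic parameters\<close>

text \<open>The excluded set is a countable union of hyperplanes with integer coefficients. Every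
  genericity fact of the proof follows from this one condition.\<close>

definition integrally_independent :: "params \<Rightarrow> bool" where
  "integrally_independent = (\<lambda>(A0, A1, A2, A3). \<forall>e0 e1 e2 e3 c :: int. (e0, e1, e2, e3) \<noteq> (0, 0, 0,
      0) \<longrightarrow>
     of_int c + of_int e0 * A0 + of_int e1 * A1 + of_int e2 * A2 + of_int e3 * A3 \<noteq> 0)"

lemma generically_integrally_independent: "holds_generically integrally_independent"
proof -
  define L :: "int \<times> int \<times> int \<times> int \<times> int \<Rightarrow> complex poly poly poly poly" where
    "L = (\<lambda>(e0, e1, e2, e3, c). [:[:[:[:of_int c, of_int e0:], [:of_int e1:]:], [:[:of_int e2:]:]:],
        [:[:[:of_int e3:]:]:]:])"
  define \<H> where "\<H> = (\<lambda>e. {A. poly4 (L e) A = 0}) ` {(e0, e1, e2, e3, c). (e0, e1, e2, e3) \<noteq> (0, 0,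
      0, 0)}"
  have L: "poly4 (L (e0, e1, e2, e3, c)) (A0, A1, A2, A3)
      = of_int c + of_int e0 * A0 + of_int e1 * A1 + of_int e2 * A2 + of_int e3 * A3"
          for e0 e1 e2 e3 c A0 A1 A2 A3
    by (simp add: poly4_def L_def algebra_simps)
  have "countable \<H>"
    unfolding \<H>_def by (rule countable_image) simp
  moreover have "\<forall>H\<in>\<H>. proper_hypersurface H"
  proof
    fix H
    assume "H \<in> \<H>"
    then obtain e0 e1 e2 e3 c where H: "H = {A. poly4 (L (e0, e1, e2, e3, c)) A = 0}"
      and nz: "(e0, e1, e2, e3) \<noteq> (0, 0, 0, 0)"
      unfolding \<H>_def by auto
    have "L (e0, e1, e2, e3, c) \<noteq> 0"
      using nz by (auto simp: L_def)
    with H show "proper_hypersurface H"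
      unfolding proper_hypersurface_def by blast
  qed
  moreover have "integrally_independent A" if "A \<notin> \<Union>\<H>" for A
  proof (cases A)
    case (fields A0 A1 A2 A3)
    have "of_int c + of_int e0 * A0 + of_int e1 * A1 + of_int e2 * A2 + of_int e3 * A3 \<noteq> 0"
      if "(e0, e1, e2, e3) \<noteq> (0, 0, 0, 0)" for e0 e1 e2 e3 c :: int
    proof
      assume "of_int c + of_int e0 * A0 + of_int e1 * A1 + of_int e2 * A2 + of_int e3 * A3 = 0"
      hence "A \<in> {A. poly4 (L (e0, e1, e2, e3, c)) A = 0}"
        by (simp add: fields L)
      moreover have "{A. poly4 (L (e0, e1, e2, e3, c)) A = 0} \<in> \<H>"
        unfolding \<H>_def by (rule imageI) (use that in simp)
      ultimately show False
        using \<open>A \<notin> \<Union>\<H>\<close> by blast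
    qed
    thus ?thesis
      unfolding integrally_independent_def fields by blast
  qed
  ultimately show ?thesis
    unfolding holds_generically_def by blast
qed

text \<open>All parameters have this shape; keeping the numerator integral makes the parity of its
  constant term available.\<close>

fun half_form :: "params \<Rightarrow> int \<Rightarrow> int \<Rightarrow> int \<Rightarrow> int \<Rightarrow> int \<Rightarrow> complex" where
  "half_form (A0, A1, A2, A3) e0 e1 e2 e3 c =
    (of_int c + of_int e0 * A0 + of_int e1 * A1 + of_int e2 * A2 + of_int e3 * A3) / 2"

lemma half_form_not_Int:
  assumes "integrally_independent A" "(e0, e1, e2, e3) \<noteq> (0, 0, 0, 0) \<or> odd c"
  shows "half_form A e0 e1 e2 e3 c \<notin> \<int>"
proof
  obtain A0 A1 A2 A3 where A: "A = (A0, A1, A2, A3)"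
    by (cases A)
  assume "half_form A e0 e1 e2 e3 c \<in> \<int>"
  then obtain m :: int where "half_form A e0 e1 e2 e3 c = of_int m"
    by (elim Ints_cases)
  hence eq: "of_int c + of_int e0 * A0 + of_int e1 * A1 + of_int e2 * A2 + of_int e3 * A3
      = of_int (2 * m)"
    unfolding A by (simp add: field_simps)
  show False
  proof (cases "(e0, e1, e2, e3) = (0, 0, 0, 0)")
    case True
    with eq have "(of_int c :: complex) = of_int (2 * m)"
      by simp
    hence "c = 2 * m"
      by (simp only: of_int_eq_iff)
    with assms(2) True show False
      by auto
  next
    case False
    hence "of_int (c - 2 * m) + of_int e0 * A0 + of_int e1 * A1 + of_int e2 * A2
        + of_int e3 * A3 \<noteq> 0"
      using assms(1) unfolding A integrally_independent_def by blast
    with eq show False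
      by (simp add: algebra_simps)
  qed
qed

lemma half_form_diff_not_Int:
  assumes "integrally_independent A" "(e0, e1, e2, e3) \<noteq> (f0, f1, f2, f3) \<or> odd (c - d)"
  shows "half_form A e0 e1 e2 e3 c - half_form A f0 f1 f2 f3 d \<notin> \<int>"
proof -
  have "half_form A e0 e1 e2 e3 c - half_form A f0 f1 f2 f3 d
      = half_form A (e0 - f0) (e1 - f1) (e2 - f2) (e3 - f3) (c - d)"
    by (cases A) (simp add: field_simps)
  thus ?thesis
    using half_form_not_Int[OF assms(1), of "e0 - f0" "e1 - f1" "e2 - f2" "e3 - f3"
        "c - d"] assms(2) by auto
qed

text \<open>As half forms, all upper parameters have constant term 1 and all lower ones 2. The odd
  constant settles the cases where the linear part is zero, such as \<alpha> 0 = 1/2 or \<alpha> 1 -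
  \<beta> 3 = -1/2 for k = 1.\<close>

lemma alpha_par_not_Int:
  assumes "integrally_independent A" "k \<in> {1..4}" "i < 4"
  shows "alpha_par k A i \<notin> \<int>" "j \<in> {1..3} \<Longrightarrow> alpha_par k A i - beta_par k A j \<notin> \<int>"
proof -
  obtain A0 A1 A2 A3 where A: "A = (A0, A1, A2, A3)"
    by (cases A)
  let ?h = "half_form A"
  define \<alpha> where "\<alpha> k = 
    (if k = 1 then [?h 0 0 0 0 1, ?h 2 0 0 0 1, ?h 1 (-1) (-1) (-1) 1, ?h 1 (-1) 1 1 1]
     else if k = 2 then [?h 0 0 0 0 1, ?h 0 0 2 0 1, ?h (-1) (-1) 1 (-1) 1, ?h 1 (-1) 1 1 1]
     else if k = 3 then [?h 2 0 0 0 1, ?h 0 0 2 0 1, ?h 1 (-1) 1 1 1, ?h 1 (-1) 1 (-1) 1]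
     else [?h 0 0 2 0 1, ?h 0 0 0 2 1, ?h 1 (-1) 1 1 1, ?h (-1) (-1) 1 1 1])" for k :: nat
  define \<beta> where "\<beta> k =
    (if k = 1 then [?h 1 (-1) (-1) 1 2, ?h 1 (-1) 1 (-1) 2, ?h 2 0 0 0 2]
     else if k = 2 then [?h (-1) (-1) 1 1 2, ?h 1 (-1) 1 (-1) 2, ?h 0 0 2 0 2]
     else if k = 3 then [?h 1 (-1) 1 1 2, ?h 1 (-1) 1 (-1) 2, ?h 2 0 2 0 2]
     else [?h 1 (-1) 1 1 2, ?h (-1) (-1) 1 1 2, ?h 0 0 2 2 2])" for k :: nat
  have \<alpha>: "alpha_par k A i = \<alpha> k ! i"
    unfolding \<alpha>_def A by (auto simp: Let_def field_simps)
  have \<beta>: "beta_par k A j = \<beta> k ! (j - 1)" for j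
    unfolding \<beta>_def A by (auto simp: Let_def add_divide_distrib diff_divide_distrib algebra_simps)
  have i: "i \<in> {0, 1, 2, 3}"
    using assms(3) by auto
  show "alpha_par k A i \<notin> \<int>"
    using i unfolding \<alpha> \<alpha>_def
    by (auto simp: half_form_not_Int[OF assms(1)] simp del: half_form.simps)
  assume "j \<in> {1..3}"
  hence j: "j \<in> {1, 2, 3}"
    by auto
  show "alpha_par k A i - beta_par k A j \<notin> \<int>"
    using i j unfolding \<alpha> \<beta> \<alpha>_def \<beta>_def
    by (auto simp: half_form_diff_not_Int[OF assms(1)] simp del: half_form.simps)
qed

section \<open>Recurrence of the coefficients\<close>

text \<open>Quotients of consecutive values, cleared of denominators. Only the factor new at step n
  must be nonzero: an earlier zero in the denominator makes both sides 0 because x/0 = 0.\<close>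

lemma lam_Suc:
  "lam 1 (A0, A1, A2, A3) (Suc n) * (of_nat n + 1) = lam 1 (A0, A1, A2, A3) n * (of_nat n + 1/2)"
  "(of_nat n + 1/2)^2 \<noteq> A0^2 \<Longrightarrow>
    lam 2 (A0, A1, A2, A3) (Suc n) * ((of_nat n + 1) * ((of_nat n + 1/2)^2 - A0^2))
      = lam 2 (A0, A1, A2, A3) n * ((of_nat n + 1/2) * ((of_nat n + 1/2)^2 - A2^2))"
  "lam 3 (A0, A1, A2, A3) (Suc n) * ((of_nat n + 1) * (of_nat n + 1/2))
      = lam 3 (A0, A1, A2, A3) n * ((of_nat n + 1/2)^2 - A2^2)"
  "(of_nat n + 1/2)^2 \<noteq> A0^2 \<Longrightarrow>
    lam 4 (A0, A1, A2, A3) (Suc n) * ((of_nat n + 1) * (of_nat n + 1/2)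
        * ((of_nat n + 1/2)^2 - A0^2))
      = lam 4 (A0, A1, A2, A3) n * (((of_nat n + 1/2)^2 - A2^2) * ((of_nat n + 1/2)^2 - A3^2))"
proof -
  define q where "q a m = pochhammer (1/2 - a) m * pochhammer (1/2 + a) m" for a :: complex and m
  have q: "q a (Suc n) = q a n * ((of_nat n + 1/2)^2 - a^2)" for a
    by (simp add: q_def pochhammer_Suc algebra_simps power2_eq_square)
  have p: "pochhammer (1/2 :: complex) (Suc n) = pochhammer (1/2) n * (of_nat n + 1/2)"
    by (simp add: pochhammer_Suc add.commute)
  have f: "fact (Suc n) = fact n * (of_nat n + 1 :: complex)"
    by (simp add: algebra_simps)
  have n1: "of_nat n + 1 \<noteq> (0 :: complex)"
    by (metis of_nat_Suc of_nat_neq_0 add.commute)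
  have n2: "of_nat n + 1/2 \<noteq> (0 :: complex)"
  proof
    assume "of_nat n + 1/2 = (0 :: complex)"
    hence "of_nat (2 * n + 1) = (0 :: complex)"
      by (simp add: field_simps)
    thus False
      by (simp only: of_nat_eq_0_iff)
  qed
  have lam: "lam 1 (A0, A1, A2, A3) m = pochhammer (1/2) m / fact m"
    "lam 2 (A0, A1, A2, A3) m = pochhammer (1/2) m * q A2 m / (fact m * q A0 m)"
    "lam 3 (A0, A1, A2, A3) m = q A2 m / (fact m * pochhammer (1/2) m)"
    "lam 4 (A0, A1, A2, A3) m = q A2 m * q A3 m / (fact m * pochhammer (1/2) m * q A0 m)" for m
    by (simp_all add: q_def Let_def)
  show "lam 1 (A0, A1, A2, A3) (Suc n) * (of_nat n + 1)
      = lam 1 (A0, A1, A2, A3) n * (of_nat n + 1/2)"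
    unfolding lam p f using n1 by simp
  show "lam 3 (A0, A1, A2, A3) (Suc n) * ((of_nat n + 1) * (of_nat n + 1/2))
      = lam 3 (A0, A1, A2, A3) n * ((of_nat n + 1/2)^2 - A2^2)"
    unfolding lam p q f using n1 n2 by (simp only: times_divide_eq_left mult_ac) simp
  assume "(of_nat n + 1/2)^2 \<noteq> A0^2"
  hence n3: "(of_nat n + 1/2)^2 - A0^2 \<noteq> 0"
    by simp
  show "lam 2 (A0, A1, A2, A3) (Suc n) * ((of_nat n + 1) * ((of_nat n + 1/2)^2 - A0^2))
      = lam 2 (A0, A1, A2, A3) n * ((of_nat n + 1/2) * ((of_nat n + 1/2)^2 - A2^2))"
    unfolding lam p q f using n1 n3 by (simp only: times_divide_eq_left mult_ac) simp
  show "lam 4 (A0, A1, A2, A3) (Suc n) * ((of_nat n + 1) * (of_nat n + 1/2)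
      * ((of_nat n + 1/2)^2 - A0^2))
      = lam 4 (A0, A1, A2, A3) n * (((of_nat n + 1/2)^2 - A2^2) * ((of_nat n + 1/2)^2 - A3^2))"
    unfolding lam p q f using n1 n2 n3 by (simp only: times_divide_eq_left mult_ac) simp
qed

lemma integrally_independent_half_ne:
  assumes "integrally_independent (A0, A1, A2, A3)"
  shows "(of_nat n + 1/2)^2 \<noteq> A0^2"
proof
  assume "(of_nat n + 1/2)^2 = A0^2"
  hence "(A0 + 1/2 - (of_nat n + 1)) * (A0 + 1/2 + of_nat n) = 0"
    by algebra
  hence "A0 + 1/2 = of_nat (n + 1) \<or> A0 + 1/2 = - of_nat n"
    unfolding mult_eq_0_iff right_minus_eq eq_neg_iff_add_eq_0 by (simp add: add.commute)
  hence "A0 + 1/2 \<in> \<int>"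
    by (metis Ints_of_nat Ints_minus)
  moreover have "A0 + 1/2 = half_form (A0, A1, A2, A3) 2 0 0 0 1"
    by (simp add: field_simps)
  ultimately show False
    using half_form_not_Int[OF assms, of 2 0 0 0 1] by simp
qed

text \<open>The factor \<kappa> is read off from the middle coefficient; the quotients of
  consecutive \<open>lam\<close> values then match the two outer ones.\<close>

lemma proportional_12:
  fixes N :: complex
  assumes "\<kappa> * (2 * N - 1) = N * l" "2 * N - 1 \<noteq> 0"
    and "lp * ((N + 1) * p) = l * ((N + 1/2) * q)" "l * (N * p') = lm * ((N - 1/2) * q')"
  shows "(N + 1) * N * p * lp = \<kappa> * ((2 * N - 1) * (N + 1/2) * q)"
    and "N^2 * r * l = \<kappa> * ((2 * N - 1) * N * r)"
    and "q' * t * lm = \<kappa> * (2 * (p' * t))"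
proof -
  show "(N + 1) * N * p * lp = \<kappa> * ((2 * N - 1) * (N + 1/2) * q)"
      "N^2 * r * l = \<kappa> * ((2 * N - 1) * N * r)"
    using assms(1,3) by algebra+
  have "(2 * N - 1) * (q' * t * lm) = (2 * N - 1) * (\<kappa> * (2 * (p' * t)))"
    using assms(1,4) by algebra
  thus "q' * t * lm = \<kappa> * (2 * (p' * t))"
    using assms(2) unfolding mult_cancel_left by blast
qed

lemma proportional_34:
  fixes N :: complex
  assumes "\<kappa> * (2 * N + 1) = N * l" "2 * N + 1 \<noteq> 0"
    and "lp * ((N + 1) * (N + 1/2) * p) = l * (q * u)" "l * (N * (N - 1/2) * p') = lm * (q' * u')"
  shows "(N + 1) * N * p * lp = \<kappa> * (2 * (q * u))"
    and "N^2 * r * l = \<kappa> * ((2 * N + 1) * N * r)"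
    and "q' * u' * lm = \<kappa> * ((2 * N + 1) * (N - 1/2) * p')"
proof -
  have "(2 * N + 1) * ((N + 1) * N * p * lp) = (2 * N + 1) * (\<kappa> * (2 * (q * u)))"
    using assms(1,3) by algebra
  thus "(N + 1) * N * p * lp = \<kappa> * (2 * (q * u))"
    using assms(2) unfolding mult_cancel_left by blast
  show "N^2 * r * l = \<kappa> * ((2 * N + 1) * N * r)" "q' * u' * lm = \<kappa> * ((2 * N + 1) * (N - 1/2) * p')"
    using assms(1,4) by algebra+
qed

lemma W1_recurrence:
  assumes indep: "integrally_independent (A0, A1, A2, A3)"
    and k: "k \<in> {1..4}" and ij: "i \<le> 7" "j \<le> 7" and n: "n \<ge> 1"
  defines "W \<equiv> W1 k i j (A0, A1, A2, A3)"
  shows "(of_nat n + 1) * of_nat n * ((of_nat n + 1/2)^2 - A0^2) * W (n + 1)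
      + of_nat n ^ 2 * (A0^2 - A1^2 + A2^2 + A3^2 - 1/2 - 2 * of_nat n ^ 2) * W n
      + ((of_nat n - 1/2)^2 - A2^2) * ((of_nat n - 1/2)^2 - A3^2) * W (n - 1) = 0"
proof -
  let ?A = "(A0, A1, A2, A3)"
  let ?N = "of_nat n :: complex"
  let ?\<alpha> = "alpha_par k ?A" and ?\<beta> = "beta_par k ?A"
  let ?D = "\<lambda>n. D1 i j n ?\<alpha> ?\<beta>"
  let ?rp = "(?N + 1) * ?N * ((?N + 1/2)^2 - A0^2)"
  let ?r0 = "?N^2 * (A0^2 - A1^2 + A2^2 + A3^2 - 1/2 - 2 * ?N^2)"
  let ?rm = "((?N - 1/2)^2 - A2^2) * ((?N - 1/2)^2 - A3^2)"
  have proportional: ?thesis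
    if "cp * ?D (n + 1) + c0 * ?D n + cm * ?D (n - 1) = 0"
      and "?rp * lam k ?A (n + 1) = \<kappa> * cp" "?r0 * lam k ?A n = \<kappa> * c0" "?rm * lam k ?A (n - 1)
          = \<kappa> * cm"
    for cp c0 cm \<kappa>
  proof -
    have "?rp * W (n + 1) + ?r0 * W n + ?rm * W (n - 1)
        = (?rp * lam k ?A (n + 1)) * ?D (n + 1) + (?r0 * lam k ?A n) * ?D n
            + (?rm * lam k ?A (n - 1)) * ?D (n - 1)"
      unfolding W_def W1_def by (simp only: mult.assoc)
    also have "\<dots> = \<kappa> * (cp * ?D (n + 1) + c0 * ?D n + cm * ?D (n - 1))"
      unfolding that(2-4) by (simp only: distrib_left mult.assoc)
    finally show ?thesis
      unfolding that(1) by simp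
  qed
  have pred: "Suc (n - 1) = n" "of_nat (n - 1) = ?N - 1" "?N - 1 + 1 = ?N" "?N - 1 + 1/2 = ?N - 1/2"
    using n by (simp_all add: of_nat_diff)
  have N: "2 * ?N - 1 \<noteq> 0" "2 * ?N + 1 \<noteq> 0"
  proof -
    have "of_nat (2 * n - 1) \<noteq> (0 :: complex)" "of_nat (2 * n + 1) \<noteq> (0 :: complex)"
      unfolding of_nat_eq_0_iff using n by auto
    moreover have "of_nat (2 * n - 1) = 2 * ?N - 1" "of_nat (2 * n + 1) = 2 * ?N + 1"
      using n by (simp_all add: of_nat_diff)
    ultimately show "2 * ?N - 1 \<noteq> 0" "2 * ?N + 1 \<noteq> 0"
      by metis+
  qed
  note half_ne = integrally_independent_half_ne[OF indep]
  have nonint: "\<And>i. i < 4 \<Longrightarrow> ?\<alpha> i \<notin> \<int>" "\<And>i j. i < 4 \<Longrightarrow> j \<in> {1..3} \<Longrightarrow> ?\<alpha> i - ?\<beta> j \<notin> \<int>"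
    by (fact alpha_par_not_Int[OF indep k])+
  consider "k = 1" | "k = 2" | "k = 3" | "k = 4"
    using k by fastforce
  thus ?thesis
  proof cases
    case 1
    \<comment> \<open>The quotient for k = 1 does not involve the A_i. A common factor on both sides
      gives it the shape of k = 2.\<close>
    have lp: "lam k ?A (n + 1) * ((?N + 1) * ((?N + 1/2)^2 - A0^2))
        = lam k ?A n * ((?N + 1/2) * ((?N + 1/2)^2 - A0^2))"
      using lam_Suc(1)[of A0 A1 A2 A3 n] unfolding 1 Suc_eq_plus1 by algebra
    have lm: "lam k ?A n * (?N * ((?N - 1/2)^2 - A2^2))
        = lam k ?A (n - 1) * ((?N - 1/2) * ((?N - 1/2)^2 - A2^2))"
      using lam_Suc(1)[of A0 A1 A2 A3 "n - 1"] unfolding 1 pred by algebra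
    have \<kappa>: "?N * lam k ?A n / (2 * ?N - 1) * (2 * ?N - 1) = ?N * lam k ?A n"
      using N(1) by simp
    have "(2 * ?N - 1) * (?N + 1/2) * ((?N + 1/2)^2 - A0^2) * ?D (n + 1)
        + (2 * ?N - 1) * ?N * (A0^2 - A1^2 + A2^2 + A3^2 - 1/2 - 2 * ?N^2) * ?D n
        + 2 * (((?N - 1/2)^2 - A2^2) * ((?N - 1/2)^2 - A3^2)) * ?D (n - 1) = 0"
      by (rule D1_recurrence_12[OF n ij nonint, where x = A0 and w = A1 and z = A2 and v = A3])
        (simp_all add: 1 Let_def)
    thus ?thesis
      by (rule proportional) (rule proportional_12[OF \<kappa> N(1) lp lm])+
  next
    case 2
    have lp: "lam k ?A (n + 1) * ((?N + 1) * ((?N + 1/2)^2 - A0^2))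
        = lam k ?A n * ((?N + 1/2) * ((?N + 1/2)^2 - A2^2))"
      unfolding 2 Suc_eq_plus1[symmetric] by (rule lam_Suc(2)[OF half_ne])
    have lm: "lam k ?A n * (?N * ((?N - 1/2)^2 - A0^2))
        = lam k ?A (n - 1) * ((?N - 1/2) * ((?N - 1/2)^2 - A2^2))"
      using lam_Suc(2)[OF half_ne[of "n - 1"]] unfolding 2 pred .
    have \<kappa>: "?N * lam k ?A n / (2 * ?N - 1) * (2 * ?N - 1) = ?N * lam k ?A n"
      using N(1) by simp
    have "(2 * ?N - 1) * (?N + 1/2) * ((?N + 1/2)^2 - A2^2) * ?D (n + 1)
        + (2 * ?N - 1) * ?N * (A0^2 - A1^2 + A2^2 + A3^2 - 1/2 - 2 * ?N^2) * ?D n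
        + 2 * (((?N - 1/2)^2 - A0^2) * ((?N - 1/2)^2 - A3^2)) * ?D (n - 1) = 0"
    proof -
      \<comment> \<open>The middle coefficient is symmetric in A0, A2, A3, so the exchange affects
        only the outer ones, where the quotient of \<open>lam 2\<close> by \<open>lam 1\<close>
        compensates it.\<close>
      have K: "A0^2 - A1^2 + A2^2 + A3^2 - 1/2 - 2 * ?N^2 = A2^2 - A1^2 + A0^2 + A3^2 - 1/2
          - 2 * ?N^2"
        by simp
      show ?thesis
        unfolding K by (rule D1_recurrence_12[OF n ij nonint, where x = A2 and w = A1 and z
            = A0 and v = A3])
        (simp_all add: 2 Let_def)
    qed
    thus ?thesis
      by (rule proportional) (rule proportional_12[OF \<kappa> N(1) lp lm])+
  next
    case 3
    have lp: "lam k ?A (n + 1) * ((?N + 1) * (?N + 1/2) * ((?N + 1/2)^2 - A0^2))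
        = lam k ?A n * (((?N + 1/2)^2 - A0^2) * ((?N + 1/2)^2 - A2^2))"
      using lam_Suc(3)[of A0 A1 A2 A3 n] unfolding 3 Suc_eq_plus1 by algebra
    have lm: "lam k ?A n * (?N * (?N - 1/2) * ((?N - 1/2)^2 - A3^2))
        = lam k ?A (n - 1) * (((?N - 1/2)^2 - A2^2) * ((?N - 1/2)^2 - A3^2))"
      using lam_Suc(3)[of A0 A1 A2 A3 "n - 1"] unfolding 3 pred by algebra
    have \<kappa>: "?N * lam k ?A n / (2 * ?N + 1) * (2 * ?N + 1) = ?N * lam k ?A n"
      using N(2) by simp
    have "2 * (((?N + 1/2)^2 - A0^2) * ((?N + 1/2)^2 - A2^2)) * ?D (n + 1)
        + (2 * ?N + 1) * ?N * (A0^2 - A1^2 + A2^2 + A3^2 - 1/2 - 2 * ?N^2) * ?D n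
        + (2 * ?N + 1) * (?N - 1/2) * ((?N - 1/2)^2 - A3^2) * ?D (n - 1) = 0"
      by (rule D1_recurrence_34[OF n ij nonint, where x = A0 and w = A1 and z = A2 and v = A3])
        (simp_all add: 3 Let_def)
    thus ?thesis
      by (rule proportional) (rule proportional_34[OF \<kappa> N(2) lp lm])+
  next
    case 4
    have lp: "lam k ?A (n + 1) * ((?N + 1) * (?N + 1/2) * ((?N + 1/2)^2 - A0^2))
        = lam k ?A n * (((?N + 1/2)^2 - A2^2) * ((?N + 1/2)^2 - A3^2))"
      unfolding 4 Suc_eq_plus1[symmetric] by (rule lam_Suc(4)[OF half_ne])
    have lm: "lam k ?A n * (?N * (?N - 1/2) * ((?N - 1/2)^2 - A0^2))
        = lam k ?A (n - 1) * (((?N - 1/2)^2 - A2^2) * ((?N - 1/2)^2 - A3^2))"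
      using lam_Suc(4)[OF half_ne[of "n - 1"]] unfolding 4 pred .
    have \<kappa>: "?N * lam k ?A n / (2 * ?N + 1) * (2 * ?N + 1) = ?N * lam k ?A n"
      using N(2) by simp
    have "2 * (((?N + 1/2)^2 - A2^2) * ((?N + 1/2)^2 - A3^2)) * ?D (n + 1)
        + (2 * ?N + 1) * ?N * (A0^2 - A1^2 + A2^2 + A3^2 - 1/2 - 2 * ?N^2) * ?D n
        + (2 * ?N + 1) * (?N - 1/2) * ((?N - 1/2)^2 - A0^2) * ?D (n - 1) = 0"
    proof -
      have K: "A0^2 - A1^2 + A2^2 + A3^2 - 1/2 - 2 * ?N^2 = A2^2 - A1^2 + A3^2 + A0^2 - 1/2
          - 2 * ?N^2"
        by simp
      show ?thesis
        unfolding K by (rule D1_recurrence_34[OF n ij nonint, where x = A2 and w = A1 and z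
            = A3 and v = A0])
        (simp_all add: 4 Let_def)
    qed
    thus ?thesis
      by (rule proportional) (rule proportional_34[OF \<kappa> N(2) lp lm])+
  qed
qed

lemma holds_generically_mono:
  assumes "holds_generically P" "\<And>A. P A \<Longrightarrow> Q A"
  shows "holds_generically Q"
proof -
  obtain \<H> where "countable \<H> \<and> (\<forall>H\<in>\<H>. proper_hypersurface H)" "\<And>A. A \<notin> \<Union>\<H> \<Longrightarrow> P A"
    using assms(1) unfolding holds_generically_def by auto
  thus ?thesis
    unfolding holds_generically_def using assms(2) by (intro exI[of _ \<H>]) auto
qed

theorem theorem11p8:
  shows "holds_generically (\<lambda>(A0, A1, A2, A3).
    \<forall>k\<in>{1..4}. \<forall>i\<in>{0..7}. \<forall>j\<in>{0..7}. i \<noteq> j \<longrightarrow>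
      solution_at_0 (A0, A1, A2, A3) (A0 - 1/2) (W1 k i j (A0, A1, A2, A3)))"
proof (rule holds_generically_mono[OF generically_integrally_independent], clarify)
  fix A0 A1 A2 A3 :: complex and k i j :: nat
  assume indep: "integrally_independent (A0, A1, A2, A3)"
    and k: "k \<in> {1..4}" and ij: "i \<in> {0..7}" "j \<in> {0..7}"
  have ij': "i \<le> 7" "j \<le> 7"
    using ij by auto
  note recurrence = W1_recurrence[OF indep k ij']
  have "conv_radius (W1 k i j (A0, A1, A2, A3)) > 0"
    by (rule recurrence_conv_radius[OF recurrence integrally_independent_half_ne[OF indep]])
  moreover have "Z (A0, A1, A2, A3) (frobenius_series (A0 - 1/2) (W1 k i j (A0, A1, A2, A3))) x = 0"
    if "x \<notin> \<real>\<^sub>\<le>\<^sub>0" "ereal (norm x) < conv_radius (W1 k i j (A0, A1, A2, A3))" for x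
    by (rule frobenius_recurrence_solution[OF recurrence that])
  ultimately show "solution_at_0 (A0, A1, A2, A3) (A0 - 1/2) (W1 k i j (A0, A1, A2, A3))"
    unfolding solution_at_0_def by simp
qed

end
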